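(* Let $1\le k\le n$. The cubical welding maps on cubical chains $\mathbf i_\star:C_\bullet(\square^n)\to C_\bullet(\star_{1,\dots,k}\square^n)$, $\mathbf p_\star:C_\bullet(\star_{1,\dots,k}\square^n)\to C_\bullet(\square^n)$, $\mathbf a_\star:C_\bullet(\star_{1,\dots,k}\square^n)\to C_{\bullet+1}(\star_{1,\dots,k}\square^n)$ form a special deformation retraction, i.e. $\mathbf i_\star,\mathbf p_\star$ are chain maps and $\mathbf p_\star\mathbf i_\star=1$, $\partial\mathbf a_\star+\mathbf a_\star\partial=1-\mathbf i_\star\mathbf p_\star$, $\mathbf a_\star^2=0$, $\mathbf a_\star\mathbf i_\star=0$, $\mathbf p_\star\mathbf a_\star=0$. Its dual is the special deformation retraction of $(C^\bullet(\star_{1,\dots,k}\square^n),d)$ onto $(C^\bullet(\square^n),d)$ with inclusion $\mathbf i^\star$, projection $\mathbf p^\star$ and homotopy $\mathbf a^\star$; i.e. $\mathbf i^\star,\mathbf p^\star,\mathbf a^\star$ are the transposes of $\mathbf p_\star,\mathbf i_\star,\mathbf a_\star$ respectively, and $\mathbf p^\star\mathbf i^\star=1$, $d\mathbf a^\star+\mathbf a^\star d=1-\mathbf i^\star\mathbf p^\star$, $(\mathbf a^\star)^2=0$, $\mathbf a^\star\mathbf i^\star=0$, $\mathbf p^\star\mathbf a^\star=0$.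
   Context: $\Delta^1$ has vertices $e_0,e_1$ and edge $[e_0,e_1]$; $\star\Delta^1$ has vertices $e_0,e_\star,e_1$ and edges $[e_0,e_\star],[e_\star,e_1]$. $C_\bullet$ are real simplicial chains, $C^\bullet$ the dual complex with $d\alpha=\alpha\circ\partial$, $\widehat\sigma$ the cochain dual to $\sigma$. $\square^n=(\Delta^1)^{\times n}$ and $\star_{1,\dots,k}\square^n=(\star\Delta^1)^{\times k}\times(\Delta^1)^{\times(n-k)}$; their cubical chain (resp. cochain) complexes are the tensor products $C_\bullet(\Delta^1)^{\otimes n}$ and $C_\bullet(\star\Delta^1)^{\otimes k}\otimes C_\bullet(\Delta^1)^{\otimes(n-k)}$ (resp. with $C^\bullet$), with the Koszul sign rule for tensor products of graded maps, and factorwise pairing $\langle\alpha\otimes\beta,x\otimes y\rangle=\alpha(x)\beta(y)$. One-dimensional maps on chains: $i_\star:e_0\mapsto e_0,\ e_1\mapsto e_1,\ [e_0,e_1]\mapsto[e_0,e_\star]+[e_\star,e_1]$; $p_\star:e_\star\mapsto\frac12(e_0+e_1),\ e_0\mapsto e_0,\ e_1\mapsto e_1,\ [e_0,e_\star]\mapsto\frac12[e_0,e_1],\ [e_\star,e_1]\mapsto\frac12[e_0,e_1]$; $a_\star:e_\star\mapsto\frac12([e_0,e_\star]-[e_\star,e_1]),\ e_0\mapsto0,\ e_1\mapsto0$, and $0$ on edges. On cochains: $i^\star:\widehat e_0\mapsto\widehat e_0+\frac12\widehat e_\star,\ \widehat e_1\mapsto\widehat e_1+\frac12\widehat e_\star,\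 \widehat{[e_0,e_1]}\mapsto\frac12(\widehat{[e_0,e_\star]}+\widehat{[e_\star,e_1]})$; $p^\star:\widehat e_0\mapsto\widehat e_0,\ \widehat e_1\mapsto\widehat e_1,\ \widehat e_\star\mapsto0,\ \widehat{[e_0,e_\star]},\widehat{[e_\star,e_1]}\mapsto\widehat{[e_0,e_1]}$; $a^\star:\widehat{[e_0,e_\star]}\mapsto\frac12\widehat e_\star,\ \widehat{[e_\star,e_1]}\mapsto-\frac12\widehat e_\star$, and $0$ on $0$-cochains. Cubical maps: $\mathbf i_\star=i_\star^{\otimes k}\otimes1^{\otimes(n-k)}$, $\mathbf p_\star=p_\star^{\otimes k}\otimes1^{\otimes(n-k)}$, $$\mathbf a_\star=\frac1{k!}\sum_{\sigma\in S_k}\tau_\sigma\circ\Big(\sum_{j=1}^k1^{\otimes(j-1)}\otimes a_\star\otimes(i_\star p_\star)^{\otimes(k-j)}\otimes1^{\otimes(n-k)}\Big)\circ\tau_\sigma^{-1},$$ where $\tau_\sigma$ permutes the first $k$ tensor factors (with Koszul signs) and fixes the rest. $\mathbf i^\star=(i^\star)^{\otimes k}\otimes1^{\otimes(n-k)}$, $\mathbf p^\star=(p^\star)^{\otimes k}\otimes1^{\otimes(n-k)}$, and $\mathbf a^\star$ is given by the same formula as $\mathbf a_\star$ with $a_\star,i_\star,p_\star$ replaced by $a^\star,i^\star,p^\star$. *)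

theory Defs
  imports Complex_Main "HOL-Library.Function_Algebras" "HOL-Combinatorics.Permutations"
begin

section \<open>Free real vector spaces on sets of cells\<close>

text \<open>
  A chain is its coefficient function, a cochain is its function of values on cells; both are
  functions from cells to \<^typ>\<open>real\<close>.  \<^term>\<open>delta c\<close> below is thus the chain \<open>c\<close>
  when read as a chain, and the cochain dual to \<open>c\<close> when read as a cochain.
  Addition, subtraction and zero of such functions are pointwise.
\<close>

type_synonym 'b vec = "'b \<Rightarrow> real"

definition delta :: "'b \<Rightarrow> 'b vec" where
  "delta c = (\<lambda>b. if b = c then 1 else 0)"

definition scale :: "real \<Rightarrow> 'b vec \<Rightarrow> 'b vec" (infixr \<open>*\<^sub>v\<close> 75) where
  "r *\<^sub>v x = (\<lambda>b. r * x b)"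

definition free_space :: "'b set \<Rightarrow> 'b vec set" where
  "free_space X = {x. \<forall>c. x c \<noteq> 0 \<longrightarrow> c \<in> X}"

text \<open>
  Linear extension of a map given on basis elements.  It is only meaningful on functions of
  finite support, which is all that occurs here.
\<close>

definition lin_ext :: "('a \<Rightarrow> 'b vec) \<Rightarrow> 'a vec \<Rightarrow> 'b vec" where
  "lin_ext f x = (\<Sum>c | x c \<noteq> 0. x c *\<^sub>v f c)"

definition pairing :: "'b vec \<Rightarrow> 'b vec \<Rightarrow> real" where
  "pairing \<alpha> x = (\<Sum>c | x c \<noteq> 0. \<alpha> c * x c)"

definition linear_between :: "'a set \<Rightarrow> 'b set \<Rightarrow> ('a vec \<Rightarrow> 'b vec) \<Rightarrow> bool" where
  "linear_between X Y f \<longleftrightarrow>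
     (\<forall>x\<in>free_space X. f x \<in> free_space Y) \<and>
     (\<forall>x\<in>free_space X. \<forall>y\<in>free_space X. f (x + y) = f x + f y) \<and>
     (\<forall>r. \<forall>x\<in>free_space X. f (r *\<^sub>v x) = r *\<^sub>v f x)"


section \<open>Special deformation retractions\<close>

text \<open>
  \<open>dg\<close> is the degree of a cell, and \<open>s\<close> is the degree of the differentials: \<open>-1\<close> for chains
  and \<open>1\<close> for cochains.
\<close>

definition graded_piece :: "('b \<Rightarrow> int) \<Rightarrow> 'b set \<Rightarrow> int \<Rightarrow> 'b vec set" where
  "graded_piece dg X q = free_space {c \<in> X. dg c = q}"

definition graded_map ::
  "('b \<Rightarrow> int) \<Rightarrow> 'b set \<Rightarrow> 'b set \<Rightarrow> int \<Rightarrow> ('b vec \<Rightarrow> 'b vec) \<Rightarrow> bool" where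
  "graded_map dg X Y r f \<longleftrightarrow> linear_between X Y f \<and>
     (\<forall>q. \<forall>x\<in>graded_piece dg X q. f x \<in> graded_piece dg Y (q + r))"

definition is_complex :: "('b \<Rightarrow> int) \<Rightarrow> int \<Rightarrow> 'b set \<Rightarrow> ('b vec \<Rightarrow> 'b vec) \<Rightarrow> bool" where
  "is_complex dg s X d \<longleftrightarrow> graded_map dg X X s d \<and> (\<forall>x\<in>free_space X. d (d x) = 0)"

definition is_complex_map :: "('b \<Rightarrow> int) \<Rightarrow> 'b set \<Rightarrow> ('b vec \<Rightarrow> 'b vec) \<Rightarrow>
    'b set \<Rightarrow> ('b vec \<Rightarrow> 'b vec) \<Rightarrow> ('b vec \<Rightarrow> 'b vec) \<Rightarrow> bool" where
  "is_complex_map dg X dX Y dY f \<longleftrightarrow>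
     graded_map dg X Y 0 f \<and> (\<forall>x\<in>free_space X. dY (f x) = f (dX x))"

text \<open>
  A special deformation retraction of \<open>(X, dX)\<close> onto \<open>(Y, dY)\<close> with inclusion \<open>i\<close>,
  projection \<open>p\<close> and homotopy \<open>a\<close>.
\<close>

definition special_deformation_retraction :: "('b \<Rightarrow> int) \<Rightarrow> int \<Rightarrow>
    'b set \<Rightarrow> ('b vec \<Rightarrow> 'b vec) \<Rightarrow> 'b set \<Rightarrow> ('b vec \<Rightarrow> 'b vec) \<Rightarrow>
    ('b vec \<Rightarrow> 'b vec) \<Rightarrow> ('b vec \<Rightarrow> 'b vec) \<Rightarrow> ('b vec \<Rightarrow> 'b vec) \<Rightarrow> bool" where
  "special_deformation_retraction dg s X dX Y dY i p a \<longleftrightarrow>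
     is_complex dg s X dX \<and> is_complex dg s Y dY \<and>
     is_complex_map dg Y dY X dX i \<and>
     is_complex_map dg X dX Y dY p \<and>
     graded_map dg X X (- s) a \<and>
     (\<forall>y\<in>free_space Y. p (i y) = y) \<and>
     (\<forall>x\<in>free_space X. dX (a x) + a (dX x) = x - i (p x)) \<and>
     (\<forall>x\<in>free_space X. a (a x) = 0) \<and>
     (\<forall>y\<in>free_space Y. a (i y) = 0) \<and>
     (\<forall>x\<in>free_space X. p (a x) = 0)"

text \<open>\<open>g\<close> (on cochains) is the transpose of \<open>f\<close> (on chains, from \<open>X\<close> to \<open>Y\<close>).\<close>

definition is_transpose ::
  "'b set \<Rightarrow> 'b set \<Rightarrow> ('b vec \<Rightarrow> 'b vec) \<Rightarrow> ('b vec \<Rightarrow> 'b vec) \<Rightarrow> bool" where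
  "is_transpose X Y f g \<longleftrightarrow>
     (\<forall>\<alpha>\<in>free_space Y. g \<alpha> \<in> free_space X) \<and>
     (\<forall>\<alpha>\<in>free_space Y. \<forall>x\<in>free_space X. pairing (g \<alpha>) x = pairing \<alpha> (f x))"


section \<open>The interval and its subdivision\<close>

datatype vertex = E0 | ES | E1

datatype cell = Vert vertex | Edge vertex vertex

fun dim :: "cell \<Rightarrow> int" where
  "dim (Vert v) = 0"
| "dim (Edge u v) = 1"

definition interval :: "cell set" where
  "interval = {Vert E0, Vert E1, Edge E0 E1}"

definition star_interval :: "cell set" where
  "star_interval = {Vert E0, Vert ES, Vert E1, Edge E0 ES, Edge ES E1}"

definition boundary1 :: "cell vec \<Rightarrow> cell vec" where
  "boundary1 = lin_ext (\<lambda>c. case c of Vert v \<Rightarrow> 0 | Edge u v \<Rightarrow> delta (Vert v) - delta (Vert u))"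

definition coboundary1 :: "cell set \<Rightarrow> cell vec \<Rightarrow> cell vec" where
  "coboundary1 K \<alpha> = (\<lambda>c. if c \<in> K then pairing \<alpha> (boundary1 (delta c)) else 0)"

text \<open>
  The one-dimensional maps, on basis elements.  Suffix \<open>l\<close> (lower star) is for chains, suffix
  \<open>u\<close> (upper star) for cochains.  Values outside the source complex are set to zero.
\<close>

fun il_basis :: "cell \<Rightarrow> cell vec" where
  "il_basis (Vert E0) = delta (Vert E0)"
| "il_basis (Vert E1) = delta (Vert E1)"
| "il_basis (Edge E0 E1) = delta (Edge E0 ES) + delta (Edge ES E1)"
| "il_basis _ = 0"

fun pl_basis :: "cell \<Rightarrow> cell vec" where
  "pl_basis (Vert ES) = (1/2) *\<^sub>v (delta (Vert E0) + delta (Vert E1))"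
| "pl_basis (Vert E0) = delta (Vert E0)"
| "pl_basis (Vert E1) = delta (Vert E1)"
| "pl_basis (Edge E0 ES) = (1/2) *\<^sub>v delta (Edge E0 E1)"
| "pl_basis (Edge ES E1) = (1/2) *\<^sub>v delta (Edge E0 E1)"
| "pl_basis _ = 0"

fun al_basis :: "cell \<Rightarrow> cell vec" where
  "al_basis (Vert ES) = (1/2) *\<^sub>v (delta (Edge E0 ES) - delta (Edge ES E1))"
| "al_basis _ = 0"

fun iu_basis :: "cell \<Rightarrow> cell vec" where
  "iu_basis (Vert E0) = delta (Vert E0) + (1/2) *\<^sub>v delta (Vert ES)"
| "iu_basis (Vert E1) = delta (Vert E1) + (1/2) *\<^sub>v delta (Vert ES)"
| "iu_basis (Edge E0 E1) = (1/2) *\<^sub>v (delta (Edge E0 ES) + delta (Edge ES E1))"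
| "iu_basis _ = 0"

fun pu_basis :: "cell \<Rightarrow> cell vec" where
  "pu_basis (Vert E0) = delta (Vert E0)"
| "pu_basis (Vert E1) = delta (Vert E1)"
| "pu_basis (Vert ES) = 0"
| "pu_basis (Edge E0 ES) = delta (Edge E0 E1)"
| "pu_basis (Edge ES E1) = delta (Edge E0 E1)"
| "pu_basis _ = 0"

fun au_basis :: "cell \<Rightarrow> cell vec" where
  "au_basis (Edge E0 ES) = (1/2) *\<^sub>v delta (Vert ES)"
| "au_basis (Edge ES E1) = - ((1/2) *\<^sub>v delta (Vert ES))"
| "au_basis _ = 0"

definition "il = lin_ext il_basis"
definition "pl = lin_ext pl_basis"
definition "al = lin_ext al_basis"
definition "iu = lin_ext iu_basis"
definition "pu = lin_ext pu_basis"
definition "au = lin_ext au_basis"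


section \<open>Tensor products with the Koszul sign rule\<close>

text \<open>
  The tensor product of free vector spaces on cells is the free vector space on lists of cells,
  \<open>c\<^sub>1 \<otimes> \<dots> \<otimes> c\<^sub>n\<close> being the list \<open>[c\<^sub>1, \<dots>, c\<^sub>n]\<close>.  For cochains the same list stands
  for the tensor product of the dual cochains, so that \<^const>\<open>pairing\<close> on lists is the
  factorwise pairing.
\<close>

definition tensor :: "cell vec list \<Rightarrow> cell list vec" where
  "tensor vs = (\<lambda>cs. if length cs = length vs then \<Prod>j<length vs. (vs ! j) (cs ! j) else 0)"

definition cell_deg :: "cell list \<Rightarrow> int" where
  "cell_deg cs = sum_list (map dim cs)"

text \<open>The sign of \<open>(f\<^sub>1 \<otimes> \<dots> \<otimes> f\<^sub>n) (x\<^sub>1 \<otimes> \<dots> \<otimes> x\<^sub>n)\<close> for degrees \<open>rs\<close> of the maps and \<open>ds\<close> of the arguments.\<close>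

definition koszul_sign :: "int list \<Rightarrow> int list \<Rightarrow> real" where
  "koszul_sign rs ds = (\<Prod>j<length rs. \<Prod>i<j. (-1) powi (rs ! j * ds ! i))"

text \<open>Tensor product of a list of linear maps, each given together with its degree.\<close>

definition tensor_map ::
  "(int \<times> (cell vec \<Rightarrow> cell vec)) list \<Rightarrow> cell list vec \<Rightarrow> cell list vec" where
  "tensor_map fs = lin_ext (\<lambda>cs. koszul_sign (map fst fs) (map dim cs) *\<^sub>v
     tensor (map2 (\<lambda>f c. snd f (delta c)) fs cs))"

definition tensor_differential ::
  "int \<Rightarrow> (cell vec \<Rightarrow> cell vec) list \<Rightarrow> cell list vec \<Rightarrow> cell list vec" where
  "tensor_differential s ds x =
     (\<Sum>j<length ds. tensor_map ((replicate (length ds) (0, id))[j := (s, ds ! j)]) x)"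

text \<open>
  The action \<open>\<tau>\<^sub>\<sigma>\<close> moves the factor at position \<open>m\<close> to position \<open>\<sigma> m\<close>; positions start at 0.
\<close>

definition perm_sign :: "(nat \<Rightarrow> nat) \<Rightarrow> int list \<Rightarrow> real" where
  "perm_sign \<sigma> ds =
     (\<Prod>(i, j) | i < j \<and> j < length ds \<and> \<sigma> j < \<sigma> i. (-1) powi (ds ! i * ds ! j))"

definition tensor_perm :: "(nat \<Rightarrow> nat) \<Rightarrow> cell list vec \<Rightarrow> cell list vec" where
  "tensor_perm \<sigma> =
     lin_ext (\<lambda>cs. perm_sign \<sigma> (map dim cs) *\<^sub>v delta (permute_list (inv \<sigma>) cs))"


section \<open>Cubes and the cubical welding maps\<close>

definition cube_factors :: "nat \<Rightarrow> cell set list" where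
  "cube_factors n = replicate n interval"

definition star_cube_factors :: "nat \<Rightarrow> nat \<Rightarrow> cell set list" where
  "star_cube_factors k n = replicate k star_interval @ replicate (n - k) interval"

definition cube :: "nat \<Rightarrow> cell list set" where
  "cube n = listset (cube_factors n)"

definition star_cube :: "nat \<Rightarrow> nat \<Rightarrow> cell list set" where
  "star_cube k n = listset (star_cube_factors k n)"

definition boundary :: "cell set list \<Rightarrow> cell list vec \<Rightarrow> cell list vec" where
  "boundary Ks = tensor_differential (- 1) (map (\<lambda>_. boundary1) Ks)"

definition coboundary :: "cell set list \<Rightarrow> cell list vec \<Rightarrow> cell list vec" where
  "coboundary Ks = tensor_differential 1 (map coboundary1 Ks)"

definition tensor_power_id ::
  "(cell vec \<Rightarrow> cell vec) \<Rightarrow> nat \<Rightarrow> nat \<Rightarrow> cell list vec \<Rightarrow> cell list vec" where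
  "tensor_power_id f k n = tensor_map (replicate k (0, f) @ replicate (n - k) (0, id))"

definition weld_homotopy_term :: "int \<Rightarrow> (cell vec \<Rightarrow> cell vec) \<Rightarrow> (cell vec \<Rightarrow> cell vec) \<Rightarrow>
    (cell vec \<Rightarrow> cell vec) \<Rightarrow> nat \<Rightarrow> nat \<Rightarrow> nat \<Rightarrow> cell list vec \<Rightarrow> cell list vec" where
  "weld_homotopy_term r a i p k n j = tensor_map
     (replicate (j - 1) (0, id) @ [(r, a)] @ replicate (k - j) (0, i \<circ> p) @ replicate (n - k) (0, id))"

text \<open>
  The common formula for both cubical homotopies; \<open>r\<close> is the degree of \<open>a\<close>.  The inverse of
  \<open>\<tau>\<^sub>\<sigma>\<close> is taken on the (co)chains of the cube \<^term>\<open>star_cube k n\<close>.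
\<close>

definition weld_homotopy :: "int \<Rightarrow> (cell vec \<Rightarrow> cell vec) \<Rightarrow> (cell vec \<Rightarrow> cell vec) \<Rightarrow>
    (cell vec \<Rightarrow> cell vec) \<Rightarrow> nat \<Rightarrow> nat \<Rightarrow> cell list vec \<Rightarrow> cell list vec" where
  "weld_homotopy r a i p k n x = (1 / fact k) *\<^sub>v
     (\<Sum>\<sigma> | \<sigma> permutes {..<k}.
        tensor_perm \<sigma>
          (\<Sum>j=1..k. weld_homotopy_term r a i p k n j
             (inv_into (free_space (star_cube k n)) (tensor_perm \<sigma>) x)))"

definition il_cube :: "nat \<Rightarrow> nat \<Rightarrow> cell list vec \<Rightarrow> cell list vec" where
  "il_cube = tensor_power_id il"

definition pl_cube :: "nat \<Rightarrow> nat \<Rightarrow> cell list vec \<Rightarrow> cell list vec" where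
  "pl_cube = tensor_power_id pl"

definition al_cube :: "nat \<Rightarrow> nat \<Rightarrow> cell list vec \<Rightarrow> cell list vec" where
  "al_cube = weld_homotopy 1 al il pl"

definition iu_cube :: "nat \<Rightarrow> nat \<Rightarrow> cell list vec \<Rightarrow> cell list vec" where
  "iu_cube = tensor_power_id iu"

definition pu_cube :: "nat \<Rightarrow> nat \<Rightarrow> cell list vec \<Rightarrow> cell list vec" where
  "pu_cube = tensor_power_id pu"

definition au_cube :: "nat \<Rightarrow> nat \<Rightarrow> cell list vec \<Rightarrow> cell list vec" where
  "au_cube = weld_homotopy (- 1) au iu pu"

end

theory Submission
  imports Defs
begin

text \<open>
  Absorb the Koszul signs into the factors: a tensor product of maps with a single odd factor at
  position \<open>m\<close> is an unsigned tensor product of matrices in which every factor before \<open>m\<close> is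
  composed with the parity operator.  Unsigned tensor products compose factor by factor, so every
  identity reduces to one on the interval, and odd maps at different positions anticommute because
  parity anticommutes with odd maps.  Conjugation by \<open>\<tau>\<^sub>\<sigma>\<close> merely permutes the factors; hence the
  homotopy is an average over \<open>\<sigma>\<close> of sums of such maps, its anticommutator with the differential
  telescopes along the order given by \<open>\<sigma>\<close>, and its square vanishes because all its summands, for
  all permutations, anticommute pairwise.  The cochain statement follows by transposition.
\<close>

section \<open>Matrices indexed by cells\<close>

text \<open>The Koszul sign of an odd factor depends on the degrees of the arguments in front of it,
  so the signed tensor product does not visibly split into a product over slots; this obstacle is
  what the parity operator removes. Write A for the homotopy on the star interval, D for the
  differential and P for the composite of inclusion and projection. From D A + A D = 1 - P, a
  summand turns into a difference: slots earlier in the order of \<sigma> carry 1, later ones carry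
  P, and the slot of A becomes 1 - P. The ends of the telescope, 1 and P in all star slots, are the
  same for every \<sigma>, so averaging with 1/k! preserves the identity. The side conditions give A
  P = P A = 0. Hence a slot in which one summand has A and another has P contributes zero in either
  order, and this lets summands from different permutations anticommute. Transposing creates no
  sign: a parity is inserted only in even slots, where row and column of a nonzero entry have equal
  parity.\<close>

type_synonym cell_matrix = "cell \<Rightarrow> cell \<Rightarrow> real"

text \<open>Finiteness of the whole type lets matrix products and linear extensions be sums over
  \<open>UNIV\<close>, with all support conditions moved into the matrix entries.\<close>

lemma cell_UNIV:
  "(UNIV::cell set) = {Vert E0, Vert ES, Vert E1, Edge E0 E0, Edge E0 ES, Edge E0 E1,
     Edge ES E0, Edge ES ES, Edge ES E1, Edge E1 E0, Edge E1 ES, Edge E1 E1}"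
proof -
  have "c \<in> {Vert E0, Vert ES, Vert E1, Edge E0 E0, Edge E0 ES, Edge E0 E1,
     Edge ES E0, Edge ES ES, Edge ES E1, Edge E1 E0, Edge E1 ES, Edge E1 E1}" for c
  proof (cases c)
    case (Vert v)
    then show ?thesis by (cases v) auto
  next
    case (Edge u v)
    then show ?thesis by (cases u; cases v) auto
  qed
  then show ?thesis by (intro equalityI subsetI UNIV_I)
qed

lemma finite_cells [simp]: "finite (A :: cell set)"
  by (rule finite_subset[OF subset_UNIV]) (simp add: cell_UNIV)

lemma finite_lists_of_length [simp]: "finite {cs :: cell list. length cs = n}"
  using finite_lists_length_eq[of "UNIV :: cell set" n] by simp

definition mat_mult :: "cell_matrix \<Rightarrow> cell_matrix \<Rightarrow> cell_matrix" (infixl \<open>\<odot>\<close> 70) where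
  "F \<odot> G = (\<lambda>c' c. \<Sum>b\<in>UNIV. F c' b * G b c)"

text \<open>Rows come first. Columns outside \<open>K\<close> are cut off, so the matrix records the
  support of its source; in particular \<open>matrix_on K id\<close> is the projection onto the span
  of \<open>K\<close>.\<close>

definition matrix_on :: "cell set \<Rightarrow> (cell vec \<Rightarrow> cell vec) \<Rightarrow> cell_matrix" where
  "matrix_on K f = (\<lambda>c' c. if c \<in> K then f (delta c) c' else 0)"

definition homogeneous :: "cell set \<Rightarrow> cell set \<Rightarrow> int \<Rightarrow> cell_matrix \<Rightarrow> bool" where
  "homogeneous X Y r F \<longleftrightarrow>
     (\<forall>c' c. F c' c \<noteq> 0 \<longrightarrow> c \<in> X \<and> c' \<in> Y \<and> dim c' = dim c + r)"

definition parity :: "cell \<Rightarrow> real" where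
  "parity c = (-1) powi dim c"

lemma parity_simps [simp]: "parity (Vert v) = 1" "parity (Edge u v) = -1"
  by (simp_all add: parity_def)

lemma parity_square [simp]: "parity c * parity c = 1" "parity c * (parity c * x) = x"
  by (cases c; simp)+

text \<open>Entrywise form of the rule that the parity operator commutes with even maps and
  anticommutes with odd ones. \<open>twist_mult\<close> and \<open>koszul_map_transpose\<close> take
  their signs from it.\<close>

lemma homogeneous_parity:
  assumes "homogeneous X Y r F" and "F c' c \<noteq> 0"
  shows "parity c' = (if even r then 1 else -1) * parity c"
proof -
  have "dim c' = dim c + r"
    using assms by (auto simp: homogeneous_def)
  then show ?thesis
    by (auto simp: parity_def power_int_minus_left)
qed

lemma lin_ext_delta [simp]: "lin_ext f (delta c) = f c"
proof -
  have "{b. delta c b \<noteq> 0} = {c}" by (auto simp: delta_def)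
  then show ?thesis by (simp add: lin_ext_def delta_def scale_def)
qed

lemma sum_fun_apply: "(\<Sum>i\<in>A. f i) x = (\<Sum>i\<in>A. (f i x :: real))"
  by (induction A rule: infinite_finite_induct) auto

lemma lin_ext_cell: "lin_ext f x c' = (\<Sum>c\<in>UNIV. x c * f c c')" for x :: "cell vec"
proof -
  have "(\<Sum>c | x c \<noteq> 0. x c * f c c') = (\<Sum>c\<in>UNIV. x c * f c c')"
    by (rule sum.mono_neutral_left) auto
  then show ?thesis by (simp add: lin_ext_def sum_fun_apply scale_def)
qed

lemma pairing_cell: "pairing \<alpha> x = (\<Sum>c\<in>UNIV. \<alpha> c * x c)" for x :: "cell vec"
  unfolding pairing_def by (rule sum.mono_neutral_left) auto

text \<open>The hypothesis keeps the image of \<open>g\<close> inside \<open>K\<close>, so that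
  cutting off the columns of the left factor at \<open>K\<close> loses no term.\<close>

lemma matrix_on_comp:
  assumes "\<And>c' c. c \<in> L \<Longrightarrow> g (delta c) c' \<noteq> 0 \<Longrightarrow> c' \<in> K"
  shows "matrix_on L (lin_ext fb \<circ> g) = matrix_on K (lin_ext fb) \<odot> matrix_on L g"
proof (intro ext)
  fix c' c
  show "matrix_on L (lin_ext fb \<circ> g) c' c = (matrix_on K (lin_ext fb) \<odot> matrix_on L g) c' c"
    using assms
    by (auto simp: matrix_on_def mat_mult_def lin_ext_cell intro!: sum.cong) metis
qed

subsection \<open>The interval and its subdivision\<close>

abbreviation "idm K \<equiv> matrix_on K id"
abbreviation "bdm K \<equiv> matrix_on K boundary1"
abbreviation "incl \<equiv> matrix_on interval il"
abbreviation "proj \<equiv> matrix_on star_interval pl"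
abbreviation "htpy \<equiv> matrix_on star_interval al"
abbreviation "incl_proj \<equiv> matrix_on star_interval (il \<circ> pl)"

lemmas lin_ext_defs = boundary1_def il_def pl_def al_def

text \<open>The sum in \<open>lin_ext\<close> runs over the support of its argument, which varies
  with the argument. Over the finite type of cells it equals a sum over \<open>UNIV\<close>, where
  linearity is termwise.\<close>

lemma lin_ext_linear [simp]:
  fixes x y :: "cell vec"
  shows "lin_ext f (x + y) = lin_ext f x + lin_ext f y"
    and "lin_ext f (x - y) = lin_ext f x - lin_ext f y"
    and "lin_ext f (r *\<^sub>v x) = r *\<^sub>v lin_ext f x"
    and "lin_ext f (0 :: cell vec) = 0"
  by (auto simp: fun_eq_iff lin_ext_cell scale_def algebra_simps sum.distrib sum_subtractf sum_distrib_left)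

lemma homogeneous_maps:
  "homogeneous K K 0 (idm K)"
  "homogeneous interval interval (-1) (bdm interval)"
  "homogeneous star_interval star_interval (-1) (bdm star_interval)"
  "homogeneous interval star_interval 0 incl"
  "homogeneous star_interval interval 0 proj"
  "homogeneous star_interval star_interval 1 htpy"
  by (auto simp: homogeneous_def matrix_on_def lin_ext_defs interval_def star_interval_def
      split: if_splits, (auto simp: delta_def scale_def split: if_splits)?)

lemma homogeneous_mult:
  assumes "homogeneous Y Z s F" and "homogeneous X Y r G"
  shows "homogeneous X Z (s + r) (F \<odot> G)"
  unfolding homogeneous_def
proof (intro allI impI)
  fix c' c
  assume "(F \<odot> G) c' c \<noteq> 0"
  then obtain b where "F c' b * G b c \<noteq> 0"
    unfolding mat_mult_def by (meson sum.not_neutral_contains_not_neutral)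
  then show "c \<in> X \<and> c' \<in> Z \<and> dim c' = dim c + (s + r)"
    using assms unfolding homogeneous_def by fastforce
qed

lemma mat_mult_assoc: "F \<odot> G \<odot> H = F \<odot> (G \<odot> H)"
proof (intro ext)
  fix c' c
  have "(F \<odot> G \<odot> H) c' c = (\<Sum>b\<in>UNIV. \<Sum>a\<in>UNIV. F c' a * G a b * H b c)"
    by (simp add: mat_mult_def sum_distrib_right)
  also have "\<dots> = (\<Sum>a\<in>UNIV. \<Sum>b\<in>UNIV. F c' a * G a b * H b c)"
    by (rule sum.swap)
  also have "\<dots> = (F \<odot> (G \<odot> H)) c' c"
    by (simp add: mat_mult_def sum_distrib_left mult.assoc)
  finally show "(F \<odot> G \<odot> H) c' c = (F \<odot> (G \<odot> H)) c' c" .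
qed

lemma idm_mult:
  assumes "homogeneous X Y r F"
  shows "idm Y \<odot> F = F" "F \<odot> idm X = F"
proof -
  have "(idm Y \<odot> F) c' c = F c' c" for c' c
  proof -
    have "(idm Y \<odot> F) c' c = (\<Sum>b\<in>UNIV. if b = c' then F c' c else 0)"
      unfolding mat_mult_def using assms
      by (intro sum.cong) (auto simp: matrix_on_def delta_def homogeneous_def)
    then show ?thesis by simp
  qed
  then show "idm Y \<odot> F = F" by blast
  have "(F \<odot> idm X) c' c = F c' c" for c' c
  proof -
    have "(F \<odot> idm X) c' c = (\<Sum>b\<in>UNIV. if b = c then F c' c else 0)"
      unfolding mat_mult_def using assms
      by (intro sum.cong) (auto simp: matrix_on_def delta_def homogeneous_def)
    then show ?thesis by simp
  qed
  then show "F \<odot> idm X = F" by blast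
qed

lemma matrix_on_mult:
  assumes "homogeneous L K r (matrix_on L g)"
  shows "matrix_on K (lin_ext fb) \<odot> matrix_on L g = matrix_on L (\<lambda>x. lin_ext fb (g x))"
proof -
  have "matrix_on L (lin_ext fb \<circ> g) = matrix_on K (lin_ext fb) \<odot> matrix_on L g"
    using assms by (intro matrix_on_comp) (auto simp: homogeneous_def matrix_on_def split: if_splits)
  then show ?thesis by (simp add: comp_def)
qed

lemma matrix_on_eqI:
  "(\<And>c. c \<in> K \<Longrightarrow> f (delta c) = g (delta c)) \<Longrightarrow> matrix_on K f = matrix_on K g"
  by (auto simp: matrix_on_def fun_eq_iff)

lemma matrix_on_arith:
  "matrix_on K f + matrix_on K g = matrix_on K (\<lambda>x. f x + g x)"
  "matrix_on K f - matrix_on K g = matrix_on K (\<lambda>x. f x - g x)"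
  "matrix_on K (\<lambda>x. 0) = 0"
  by (auto simp: matrix_on_def fun_eq_iff)

text \<open>Rewrite rules that turn a product of matrices into the matrix of a composite. Unfolding
  to \<open>lin_ext\<close> gives the left factor the shape that \<open>matrix_on_mult\<close>
  expects; an identity then has to be checked only on three or five basis cells.\<close>

lemmas mult_maps = homogeneous_maps(2-)[unfolded lin_ext_defs, THEN matrix_on_mult]

lemma eq_on_cells:
  "f (delta (Vert E0)) = g (delta (Vert E0)) \<Longrightarrow> f (delta (Vert E1)) = g (delta (Vert E1)) \<Longrightarrow>
   f (delta (Edge E0 E1)) = g (delta (Edge E0 E1)) \<Longrightarrow> matrix_on interval f = matrix_on interval g"
  "f (delta (Vert E0)) = g (delta (Vert E0)) \<Longrightarrow> f (delta (Vert ES)) = g (delta (Vert ES)) \<Longrightarrow>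
   f (delta (Vert E1)) = g (delta (Vert E1)) \<Longrightarrow>
   f (delta (Edge E0 ES)) = g (delta (Edge E0 ES)) \<Longrightarrow>
   f (delta (Edge ES E1)) = g (delta (Edge ES E1)) \<Longrightarrow>
   matrix_on star_interval f = matrix_on star_interval g"
  by (rule matrix_on_eqI, auto simp: interval_def star_interval_def)+

lemmas zero_on_cells =
  eq_on_cells(1)[where g = "\<lambda>_. 0", unfolded matrix_on_arith(3)]
  eq_on_cells(2)[where g = "\<lambda>_. 0", unfolded matrix_on_arith(3)]

lemmas eval_maps = lin_ext_delta lin_ext_linear il_basis.simps pl_basis.simps al_basis.simps
  cell.case id_apply

section \<open>The special deformation retraction of a single subdivided interval\<close>

lemma proj_incl: "proj \<odot> incl = idm interval"
  unfolding lin_ext_defs mult_maps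
  by (rule eq_on_cells; simp only: eval_maps; simp add: fun_eq_iff scale_def field_simps)

lemma bdm_incl: "bdm star_interval \<odot> incl = incl \<odot> bdm interval"
  unfolding lin_ext_defs mult_maps
  by (rule eq_on_cells; simp only: eval_maps; simp add: fun_eq_iff scale_def)

lemma bdm_proj: "bdm interval \<odot> proj = proj \<odot> bdm star_interval"
  unfolding lin_ext_defs mult_maps
  by (rule eq_on_cells; simp only: eval_maps; simp add: fun_eq_iff scale_def field_simps)

lemma bdm_bdm_interval: "bdm interval \<odot> bdm interval = 0"
  unfolding lin_ext_defs mult_maps
  by (rule zero_on_cells; simp only: eval_maps; simp add: fun_eq_iff scale_def)

lemma bdm_bdm_star: "bdm star_interval \<odot> bdm star_interval = 0"
  unfolding lin_ext_defs mult_maps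
  by (rule zero_on_cells; simp only: eval_maps; simp add: fun_eq_iff scale_def)

lemma htpy_htpy: "htpy \<odot> htpy = 0"
  unfolding lin_ext_defs mult_maps
  by (rule zero_on_cells; simp only: eval_maps; simp add: fun_eq_iff scale_def)

lemma htpy_incl: "htpy \<odot> incl = 0"
  unfolding lin_ext_defs mult_maps
  by (rule zero_on_cells; simp only: eval_maps; simp add: fun_eq_iff scale_def)

lemma proj_htpy: "proj \<odot> htpy = 0"
  unfolding lin_ext_defs mult_maps
  by (rule zero_on_cells; simp only: eval_maps; simp add: fun_eq_iff scale_def)

text \<open>The constant 1/2 and the minus sign in the homotopy come from here: the boundary of half
  the difference of the two edges is e_star minus the midpoint (e_0 + e_1)/2, and half that
  difference is also the deviation of \<open>Edge E0 ES\<close> from the mean of the two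
  edges.\<close>

lemma bdm_htpy:
  "bdm star_interval \<odot> htpy + htpy \<odot> bdm star_interval = idm star_interval - incl \<odot> proj"
  unfolding lin_ext_defs mult_maps matrix_on_arith
  by (rule eq_on_cells; simp only: eval_maps; simp add: fun_eq_iff scale_def field_simps)

lemma incl_proj_eq: "incl_proj = incl \<odot> proj"
  unfolding lin_ext_defs mult_maps comp_def by (rule refl)

text \<open>\<open>coboundary1 K\<close> cuts off the row index and \<open>matrix_on\<close> the
  column index. The boundary matrix cuts off columns by definition and has no entries in rows
  outside \<open>K\<close> by homogeneity, so the two agree after transposing.\<close>

lemma coboundary_matrix:
  assumes "K = interval \<or> K = star_interval"
  shows "matrix_on K (coboundary1 K) c c' = bdm K c' c"
proof -
  have "(\<Sum>b\<in>UNIV. delta c' b * boundary1 (delta c) b) = boundary1 (delta c) c'"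
    by (subst sum.remove[of _ c']) (auto simp: delta_def)
  moreover have "bdm K c' c = 0" if "c' \<notin> K"
    using homogeneous_maps(2,3) assms that by (auto simp: homogeneous_def)
  ultimately show ?thesis
    by (auto simp: matrix_on_def coboundary1_def pairing_cell)
qed

lemma upper_matrix:
  "matrix_on interval iu c c' = proj c' c"
  "matrix_on star_interval pu c c' = incl c' c"
  "matrix_on star_interval au c c' = htpy c' c"
  by (auto simp: matrix_on_def iu_def pu_def au_def il_def pl_def al_def interval_def star_interval_def)
     (auto simp: delta_def scale_def)

section \<open>Tensor products of matrices\<close>

text \<open>Summing over all lists of length \<open>n\<close>, a finite set, makes this linear on
  arbitrary functions, whereas \<open>lin_ext\<close> on lists is meaningful only for finite
  support.\<close>

definition tensor_matrix :: "nat \<Rightarrow> (nat \<Rightarrow> cell_matrix) \<Rightarrow> cell list vec \<Rightarrow> cell list vec" where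
  "tensor_matrix n F x = (\<lambda>cs'. if length cs' = n
     then \<Sum>cs | length cs = n. (\<Prod>j<n. F j (cs' ! j) (cs ! j)) * x cs else 0)"

definition box :: "nat \<Rightarrow> (nat \<Rightarrow> cell set) \<Rightarrow> cell list set" where
  "box n K = {cs. length cs = n \<and> (\<forall>j<n. cs ! j \<in> K j)}"

text \<open>The parity is that of the column \<open>c\<close>: the sign is read off the argument,
  before \<open>F j\<close> acts.\<close>

definition twist :: "nat \<Rightarrow> (nat \<Rightarrow> cell_matrix) \<Rightarrow> nat \<Rightarrow> cell_matrix" where
  "twist m F j = (\<lambda>c' c. (if j < m then parity c else 1) * F j c' c)"

lemma finite_box [simp]: "finite (box n K)"
  by (rule finite_subset[OF _ finite_lists_of_length[of n]]) (auto simp: box_def)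

text \<open>General distributivity, by splitting a list into head and tail. In
  \<open>tensor_matrix_mult\<close> it is applied to the sum over intermediate lists.\<close>

lemma sum_lists_prod:
  fixes f :: "nat \<Rightarrow> cell \<Rightarrow> real"
  shows "(\<Sum>cs | length cs = n. \<Prod>j<n. f j (cs ! j)) = (\<Prod>j<n. \<Sum>c\<in>UNIV. f j c)"
proof (induction n arbitrary: f)
  case 0
  then show ?case by simp
next
  case (Suc n)
  have eq: "{cs. length cs = Suc n} = (\<lambda>(c, cs). c # cs) ` (UNIV \<times> {cs :: cell list. length cs = n})"
    by (auto simp: length_Suc_conv image_iff)
  have "(\<Sum>cs | length cs = Suc n. \<Prod>j<Suc n. f j (cs ! j))
      = (\<Sum>(c, cs)\<in>UNIV \<times> {cs. length cs = n}. f 0 c * (\<Prod>j<n. f (Suc j) (cs ! j)))"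
    unfolding eq by (subst sum.reindex)
      (auto simp: inj_on_def prod.lessThan_Suc_shift case_prod_unfold simp del: prod.lessThan_Suc
        intro!: sum.cong)
  also have "\<dots> = (\<Sum>c\<in>UNIV. f 0 c) * (\<Sum>cs | length cs = n. \<Prod>j<n. f (Suc j) (cs ! j))"
    by (simp add: sum_product sum.cartesian_product)
  finally show ?case
    by (simp add: Suc.IH[of "\<lambda>j. f (Suc j)"] prod.lessThan_Suc_shift del: prod.lessThan_Suc)
qed

lemma tensor_matrix_cong:
  "(\<And>j. j < n \<Longrightarrow> F j = G j) \<Longrightarrow> tensor_matrix n F x = tensor_matrix n G x"
  unfolding tensor_matrix_def
  by (intro ext if_cong refl sum.cong arg_cong2[where f = "(*)"] prod.cong) auto

lemma tensor_matrix_mult: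
  "tensor_matrix n F (tensor_matrix n G x) = tensor_matrix n (\<lambda>j. F j \<odot> G j) x"
proof
  fix cs'
  let ?L = "{cs :: cell list. length cs = n}"
  have "(\<Sum>bs\<in>?L. (\<Prod>j<n. F j (cs' ! j) (bs ! j)) * (\<Sum>cs\<in>?L. (\<Prod>j<n. G j (bs ! j) (cs ! j)) * x cs))
      = (\<Sum>bs\<in>?L. \<Sum>cs\<in>?L. (\<Prod>j<n. F j (cs' ! j) (bs ! j) * G j (bs ! j) (cs ! j)) * x cs)"
    by (simp add: sum_distrib_left prod.distrib mult.assoc)
  also have "\<dots> = (\<Sum>cs\<in>?L. (\<Sum>bs\<in>?L. \<Prod>j<n. F j (cs' ! j) (bs ! j) * G j (bs ! j) (cs ! j)) * x cs)"
    by (subst sum.swap) (simp add: sum_distrib_right)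
  also have "\<dots> = (\<Sum>cs\<in>?L. (\<Prod>j<n. (F j \<odot> G j) (cs' ! j) (cs ! j)) * x cs)"
    by (simp add: sum_lists_prod[where f = "\<lambda>j b. F j (cs' ! j) b * G j b (_ ! j)"] mat_mult_def)
  finally show "tensor_matrix n F (tensor_matrix n G x) cs' = tensor_matrix n (\<lambda>j. F j \<odot> G j) x cs'"
    by (simp add: tensor_matrix_def)
qed

lemma tensor_matrix_add: "tensor_matrix n F (x + y) = tensor_matrix n F x + tensor_matrix n F y"
  by (auto simp: tensor_matrix_def fun_eq_iff distrib_left sum.distrib)

lemma tensor_matrix_scale: "tensor_matrix n F (r *\<^sub>v x) = r *\<^sub>v tensor_matrix n F x"
  by (auto simp: tensor_matrix_def fun_eq_iff scale_def sum_distrib_left algebra_simps)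

lemma tensor_matrix_0: "tensor_matrix n F 0 = 0"
  by (auto simp: tensor_matrix_def fun_eq_iff)

lemma tensor_matrix_sum: "tensor_matrix n F (\<Sum>i\<in>A. x i) = (\<Sum>i\<in>A. tensor_matrix n F (x i))"
  by (induction A rule: infinite_finite_induct) (simp_all only: sum.infinite sum.empty sum.insert tensor_matrix_add tensor_matrix_0 not_False_eq_True)

lemma tensor_matrix_scale_factors:
  "tensor_matrix n (\<lambda>j c' c. a j * F j c' c) x = (\<Prod>j<n. a j) *\<^sub>v tensor_matrix n F x"
  by (auto simp: tensor_matrix_def fun_eq_iff scale_def prod.distrib sum_distrib_left mult.assoc)

lemma tensor_matrix_factor_zero:
  assumes "l < n" and "F l = 0"
  shows "tensor_matrix n F x = 0"
proof -
  have "(\<Prod>j<n. F j (cs' ! j) (cs ! j)) = 0" for cs' cs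
    using assms by (intro prod_zero bexI[of _ l]) auto
  then show ?thesis unfolding tensor_matrix_def by (simp only: mult_zero_left sum.neutral_const) (simp add: fun_eq_iff)
qed

text \<open>Linearity in one slot; it is how the interval identity for the homotopy enters the
  telescoping.\<close>

lemma tensor_matrix_factor_add:
  assumes "l < n"
  shows "tensor_matrix n (F(l := A + B)) x = tensor_matrix n (F(l := A)) x + tensor_matrix n (F(l := B)) x"
proof -
  have "(\<Prod>j<n. (F(l := C)) j (cs' ! j) (cs ! j))
      = C (cs' ! l) (cs ! l) * (\<Prod>j\<in>{..<n} - {l}. F j (cs' ! j) (cs ! j))" for C cs' cs
    using assms by (subst prod.remove[of _ l]) (auto intro!: prod.cong)
  then show ?thesis
    by (auto simp: tensor_matrix_def fun_eq_iff distrib_right sum.distrib)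
qed

lemma tensor_matrix_idm:
  assumes "x \<in> free_space (box n K)"
  shows "tensor_matrix n (\<lambda>j. idm (K j)) x = x"
proof
  fix cs'
  have *: "(\<Prod>j<n. idm (K j) (cs' ! j) (cs ! j)) * x cs = (if cs = cs' then x cs' else 0)"
    if len: "length cs = n" "length cs' = n" for cs
  proof (cases "cs = cs'")
    case True
    then show ?thesis
      using assms len
      by (cases "cs' \<in> box n K") (auto simp: free_space_def box_def matrix_on_def delta_def)
  next
    case False
    then obtain j where "j < n" "cs ! j \<noteq> cs' ! j"
      using len by (metis nth_equalityI)
    then have "(\<Prod>j<n. idm (K j) (cs' ! j) (cs ! j)) = 0"
      by (intro prod_zero bexI[of _ j]) (auto simp: matrix_on_def delta_def)
    then show ?thesis using False by simp
  qed
  show "tensor_matrix n (\<lambda>j. idm (K j)) x cs' = x cs'"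
  proof (cases "length cs' = n")
    case True
    then have "tensor_matrix n (\<lambda>j. idm (K j)) x cs'
        = (\<Sum>cs | length cs = n. if cs = cs' then x cs' else 0)"
      unfolding tensor_matrix_def by (auto intro!: sum.cong simp: *)
    also have "\<dots> = x cs'" using True by simp
    finally show ?thesis .
  next
    case False
    then show ?thesis using assms by (auto simp: tensor_matrix_def free_space_def box_def)
  qed
qed

lemma cell_deg_nth: "cell_deg cs = (\<Sum>j<length cs. dim (cs ! j))"
  by (simp add: cell_deg_def sum_list_sum_nth atLeast0LessThan)

lemma tensor_matrix_graded:
  assumes hom: "\<And>j. j < n \<Longrightarrow> homogeneous (K j) (L j) (r j) (F j)"
    and R: "R = (\<Sum>j<n. r j)"
  shows "graded_map cell_deg (box n K) (box n L) R (tensor_matrix n F)"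
proof -
  \<comment> \<open>A nonzero value at \<open>cs'\<close> forces a nonzero summand, all of whose
    factors are then nonzero, so homogeneity applies in every slot and the degrees add up.\<close>
  have *: "cs' \<in> box n L \<and> (\<exists>cs \<in> box n K. x cs \<noteq> 0 \<and> cell_deg cs' = cell_deg cs + R)"
    if nz: "tensor_matrix n F x cs' \<noteq> 0" for x cs'
  proof -
    have len: "length cs' = n"
      using nz by (auto simp: tensor_matrix_def split: if_splits)
    obtain cs where cs: "length cs = n" "(\<Prod>j<n. F j (cs' ! j) (cs ! j)) * x cs \<noteq> 0"
    proof -
      have "(\<Sum>cs | length cs = n. (\<Prod>j<n. F j (cs' ! j) (cs ! j)) * x cs) \<noteq> 0"
        using nz len by (simp add: tensor_matrix_def)
      then show ?thesis
        using that by (auto elim: sum.not_neutral_contains_not_neutral)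
    qed
    have "F j (cs' ! j) (cs ! j) \<noteq> 0" if "j < n" for j
      using cs(2) that by auto
    then have j: "cs ! j \<in> K j \<and> cs' ! j \<in> L j \<and> dim (cs' ! j) = dim (cs ! j) + r j" if "j < n" for j
      using hom[OF that] that unfolding homogeneous_def by blast
    then have "cell_deg cs' = cell_deg cs + R"
      using cs(1) len by (simp add: cell_deg_nth sum.distrib R)
    then show ?thesis
      using j cs len by (auto simp: box_def)
  qed
  have "tensor_matrix n F x \<in> free_space (box n L)" for x
    using * by (auto simp: free_space_def)
  moreover have "tensor_matrix n F x \<in> graded_piece cell_deg (box n L) (q + R)"
    if "x \<in> graded_piece cell_deg (box n K) q" for x q
    using that * by (fastforce simp: graded_piece_def free_space_def)
  ultimately show ?thesis
    by (simp add: graded_map_def linear_between_def tensor_matrix_add tensor_matrix_scale)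
qed

section \<open>Koszul signs as twists by the parity\<close>

lemma homogeneous_twist:
  "homogeneous X Y r (F j) \<Longrightarrow> homogeneous X Y r (twist m F j)"
  by (auto simp: homogeneous_def twist_def)

lemma twist_0: "twist 0 F = F"
  by (auto simp: twist_def)

text \<open>Both parities are pulled to the column of the product. The parity of the intermediate
  cell passes \<open>G j\<close> at the cost of a sign when \<open>r\<close> is odd, and where both
  twists act the two parities cancel; hence the exclusive-or.\<close>

lemma twist_mult:
  assumes "homogeneous X Y r (G j)"
  shows "twist u F j \<odot> twist v G j = (\<lambda>c' c. (if j < u \<and> odd r then -1 else 1) *
    ((if (j < u) \<noteq> (j < v) then parity c else 1) * (F j \<odot> G j) c' c))"
proof (intro ext)
  fix c' c
  have *: "G j b c * parity b = G j b c * ((if odd r then -1 else 1) * parity c)" for b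
    using homogeneous_parity[OF assms, of b c] by (cases "G j b c = 0") auto
  have "(if j < u then parity b else 1) * F j c' b * ((if j < v then parity c else 1) * G j b c)
    = (if j < u \<and> odd r then -1 else 1) *
       ((if (j < u) \<noteq> (j < v) then parity c else 1) * (F j c' b * G j b c))" for b
    using *[of b] by (auto simp: algebra_simps)
  then show "(twist u F j \<odot> twist v G j) c' c = (if j < u \<and> odd r then -1 else 1) *
      ((if (j < u) \<noteq> (j < v) then parity c else 1) * (F j \<odot> G j) c' c)"
    unfolding mat_mult_def twist_def sum_distrib_left by (intro sum.cong refl)
qed

text \<open>
  \<open>koszul_map n m F\<close> is the tensor product, with Koszul signs, of maps that are even except
  possibly at position \<open>m\<close>: the odd map at \<open>m\<close> sees the parities of all factors before it.
\<close>

definition koszul_map :: "nat \<Rightarrow> nat \<Rightarrow> (nat \<Rightarrow> cell_matrix) \<Rightarrow> cell list vec \<Rightarrow> cell list vec" where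
  "koszul_map n m F = tensor_matrix n (twist m F)"

lemma koszul_map_cong:
  "(\<And>j. j < n \<Longrightarrow> F j = G j) \<Longrightarrow> koszul_map n m F x = koszul_map n m G x"
  unfolding koszul_map_def by (rule tensor_matrix_cong) (simp add: twist_def)

text \<open>With \<open>u < v\<close> exactly one order of composition yields a sign. When
  \<open>F\<close> acts last, its twist stops before \<open>v\<close>, the only slot where
  \<open>G\<close> may be odd. When \<open>G\<close> acts last, its twist covers \<open>u\<close>,
  where \<open>F\<close> is odd, and produces -1.\<close>

lemma koszul_map_anticommute_aux:
  assumes "u < v" "v < n" "odd r"
    and "\<And>j. j < n \<Longrightarrow> homogeneous (K j) (K j) (if j = u then r else 0) (F j)"
    and "\<And>j. j < n \<Longrightarrow> homogeneous (K j) (K j) (if j = v then s else 0) (G j)"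
    and "\<And>j. j < n \<Longrightarrow> F j \<odot> G j = G j \<odot> F j"
  shows "koszul_map n u F (koszul_map n v G x) + koszul_map n v G (koszul_map n u F x) = 0"
proof -
  define H where "H = (\<lambda>j c' c. (if (j < u) \<noteq> (j < v) then parity c else 1) * (F j \<odot> G j) c' c)"
  have "koszul_map n u F (koszul_map n v G x) = tensor_matrix n H x"
    unfolding koszul_map_def tensor_matrix_mult
  proof (rule tensor_matrix_cong)
    fix j assume "j < n"
    then show "twist u F j \<odot> twist v G j = H j"
      using assms(1) by (subst twist_mult[OF assms(5)]) (auto simp: H_def fun_eq_iff)
  qed
  moreover have "koszul_map n v G (koszul_map n u F x)
      = tensor_matrix n (\<lambda>j c' c. (if j = u then -1 else 1) * H j c' c) x"
    unfolding koszul_map_def tensor_matrix_mult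
  proof (rule tensor_matrix_cong)
    fix j assume "j < n"
    then show "twist v G j \<odot> twist u F j = (\<lambda>c' c. (if j = u then -1 else 1) * H j c' c)"
      using assms(1,3) by (subst twist_mult[OF assms(4)]) (auto simp: H_def assms(6) fun_eq_iff)
  qed
  moreover have "(\<Prod>j<n. if j = u then - 1 else 1 :: real) = -1"
    using assms(1,2) by simp
  ultimately show ?thesis
    by (simp add: tensor_matrix_scale_factors scale_def fun_eq_iff)
qed

lemma koszul_map_anticommute:
  assumes "u \<noteq> v" "u < n" "v < n" "odd r" "odd s"
    and "\<And>j. j < n \<Longrightarrow> homogeneous (K j) (K j) (if j = u then r else 0) (F j)"
    and "\<And>j. j < n \<Longrightarrow> homogeneous (K j) (K j) (if j = v then s else 0) (G j)"
    and "\<And>j. j < n \<Longrightarrow> F j \<odot> G j = G j \<odot> F j"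
  shows "koszul_map n u F (koszul_map n v G x) + koszul_map n v G (koszul_map n u F x) = 0"
proof (cases "u < v")
  case True
  show ?thesis
    by (rule koszul_map_anticommute_aux[OF True assms(3,4,6-8)])
next
  case False
  then have "v < u" using assms(1) by simp
  then have "koszul_map n v G (koszul_map n u F x) + koszul_map n u F (koszul_map n v G x) = 0"
    by (rule koszul_map_anticommute_aux[OF _ assms(2,5,7,6) assms(8)[symmetric]])
  then show ?thesis by (simp add: add.commute)
qed

text \<open>In the slots before \<open>u\<close> the two parities meet across even factors of
  \<open>G\<close> and square to one, so the composite is an unsigned tensor product.\<close>

lemma koszul_map_same_position:
  assumes "\<And>j. j < n \<Longrightarrow> homogeneous (K j) (L j) (if j = u then s else 0) (G j)"
  shows "koszul_map n u F (koszul_map n u G x) = tensor_matrix n (\<lambda>j. F j \<odot> G j) x"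
  unfolding koszul_map_def tensor_matrix_mult
proof (rule tensor_matrix_cong)
  fix j assume "j < n"
  then show "twist u F j \<odot> twist u G j = F j \<odot> G j"
    by (subst twist_mult[OF assms]) auto
qed

lemma koszul_map_tensor_matrix:
  assumes "\<And>j. j < n \<Longrightarrow> homogeneous (K j) (L j) 0 (E j)"
  shows "koszul_map n u F (tensor_matrix n E x) = koszul_map n u (\<lambda>j. F j \<odot> E j) x"
  unfolding koszul_map_def tensor_matrix_mult
proof (rule tensor_matrix_cong)
  fix j assume "j < n"
  \<comment> \<open>The even factor is read as a twist ending at 0, which makes
    \<open>twist_mult\<close> applicable.\<close>
  then have "twist u F j \<odot> twist 0 E j = twist u (\<lambda>j. F j \<odot> E j) j"
    by (subst twist_mult[OF assms]) (auto simp: twist_def)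
  then show "twist u F j \<odot> E j = twist u (\<lambda>j. F j \<odot> E j) j"
    by (simp add: twist_0)
qed

text \<open>The parity sits on the column side and \<open>E j\<close> multiplies from the left, so
  it comes out of the sum; in \<open>koszul_map_tensor_matrix\<close> it has to be carried past the
  even factor.\<close>

lemma tensor_matrix_koszul_map:
  "tensor_matrix n E (koszul_map n u F x) = koszul_map n u (\<lambda>j. E j \<odot> F j) x"
  unfolding koszul_map_def tensor_matrix_mult
  by (rule tensor_matrix_cong) (auto simp: twist_def mat_mult_def sum_distrib_left algebra_simps)

lemma koszul_map_zero:
  "l < n \<Longrightarrow> F l = 0 \<Longrightarrow> koszul_map n m F x = 0"
  unfolding koszul_map_def by (rule tensor_matrix_factor_zero) (auto simp: twist_def fun_eq_iff)

lemma koszul_map_linear: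
  "koszul_map n m F (x + y) = koszul_map n m F x + koszul_map n m F y"
  "koszul_map n m F (r *\<^sub>v x) = r *\<^sub>v koszul_map n m F x"
  "koszul_map n m F (\<Sum>i\<in>A. f i) = (\<Sum>i\<in>A. koszul_map n m F (f i))"
  by (simp_all add: koszul_map_def tensor_matrix_add tensor_matrix_scale tensor_matrix_sum)

lemma koszul_map_graded:
  assumes "\<And>j. j < n \<Longrightarrow> homogeneous (K j) (L j) (if j = m then r else 0) (F j)" and "m < n"
  shows "graded_map cell_deg (box n K) (box n L) r (koszul_map n m F)"
  unfolding koszul_map_def
  by (rule tensor_matrix_graded, rule homogeneous_twist, rule assms(1)) (use assms(2) in auto)

section \<open>Cubes and their tensor maps\<close>

lemma listset_iff: "cs \<in> listset As \<longleftrightarrow> length cs = length As \<and> (\<forall>j<length As. cs ! j \<in> As ! j)"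
proof (induction As arbitrary: cs)
  case (Cons A As)
  show ?case
    by (cases cs) (auto simp: set_Cons_def Cons.IH All_less_Suc2)
qed simp

definition star_factor :: "nat \<Rightarrow> nat \<Rightarrow> cell set" where
  "star_factor k j = (if j < k then star_interval else interval)"

lemma nth_cube_factors: "j < n \<Longrightarrow> cube_factors n ! j = interval"
  by (simp add: cube_factors_def)

lemma nth_star_cube_factors:
  "k \<le> n \<Longrightarrow> j < n \<Longrightarrow> star_cube_factors k n ! j = star_factor k j"
  by (simp add: star_cube_factors_def star_factor_def nth_append)

lemma length_factors [simp]:
  "length (cube_factors n) = n" "k \<le> n \<Longrightarrow> length (star_cube_factors k n) = n"
  by (simp_all add: cube_factors_def star_cube_factors_def)

lemma cube_eq_box: "cube n = box n (\<lambda>_. interval)"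
  by (auto simp: cube_def box_def listset_iff nth_cube_factors)

lemma star_cube_eq_box: "k \<le> n \<Longrightarrow> star_cube k n = box n (star_factor k)"
  by (auto simp: star_cube_def box_def listset_iff nth_star_cube_factors)

lemma odd_powi: "odd r \<Longrightarrow> (-1 :: real) powi (r * d) = (-1) powi d"
  by (auto simp: power_int_minus_left)

text \<open>Only the row \<open>j = m\<close> of the double product survives. The result is spread
  over all \<open>i < n\<close> so that it merges slot by slot with the product of matrix
  entries.\<close>

lemma koszul_sign_single:
  assumes "length rs = n" "length ds = n" "m < n" "odd (rs ! m)"
    and "\<And>j. j < n \<Longrightarrow> j \<noteq> m \<Longrightarrow> rs ! j = 0"
  shows "koszul_sign rs ds = (\<Prod>i<n. if i < m then (-1) powi (ds ! i) else 1)"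
proof -
  have "koszul_sign rs ds
      = (\<Prod>j<n. if j = m then \<Prod>i<m. (-1) powi (ds ! i) else 1)"
    unfolding koszul_sign_def assms(1)
    by (intro prod.cong refl) (auto simp: assms odd_powi)
  also have "\<dots> = (\<Prod>i<m. (-1) powi (ds ! i))"
    using assms(3) by simp
  also have "\<dots> = (\<Prod>i<n. if i < m then (-1) powi (ds ! i) else 1)"
    using assms(3) by (intro prod.mono_neutral_cong_left) auto
  finally show ?thesis .
qed

lemma koszul_sign_even:
  assumes "\<And>j. j < length rs \<Longrightarrow> rs ! j = 0"
  shows "koszul_sign rs ds = 1"
  unfolding koszul_sign_def by (intro prod.neutral ballI) (simp add: assms)

text \<open>Replacing the maps by matrices cut off at \<open>K\<close> is harmless, since
  \<open>x cs\<close> is nonzero only if every entry of \<open>cs\<close> lies in its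
  \<open>K j\<close>. The restriction on \<open>x\<close> also makes the support sum in
  \<open>lin_ext\<close> finite.\<close>

lemma tensor_map_apply:
  assumes "length fs = n" and "x \<in> free_space (box n K)"
  shows "tensor_map fs x = (\<lambda>cs'. if length cs' = n
    then \<Sum>cs | length cs = n. koszul_sign (map fst fs) (map dim cs) *
      (\<Prod>j<n. matrix_on (K j) (snd (fs ! j)) (cs' ! j) (cs ! j)) * x cs else 0)"
proof
  fix cs'
  let ?t = "\<lambda>cs. x cs * (koszul_sign (map fst fs) (map dim cs) *
    tensor (map2 (\<lambda>f c. snd f (delta c)) fs cs) cs')"
  have "tensor_map fs x cs' = (\<Sum>cs | x cs \<noteq> 0. ?t cs)"
    by (simp add: tensor_map_def lin_ext_def sum_fun_apply scale_def)
  also have "\<dots> = (\<Sum>cs | length cs = n. ?t cs)"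
    using assms(2) by (intro sum.mono_neutral_left) (auto simp: free_space_def box_def)
  also have "\<dots> = (\<Sum>cs | length cs = n. if length cs' = n then
      koszul_sign (map fst fs) (map dim cs) *
      (\<Prod>j<n. matrix_on (K j) (snd (fs ! j)) (cs' ! j) (cs ! j)) * x cs else 0)"
  proof (rule sum.cong[OF refl])
    fix cs :: "cell list" assume "cs \<in> {cs. length cs = n}"
    then have len: "length cs = n" by simp
    show "?t cs = (if length cs' = n then koszul_sign (map fst fs) (map dim cs) *
      (\<Prod>j<n. matrix_on (K j) (snd (fs ! j)) (cs' ! j) (cs ! j)) * x cs else 0)"
    proof (cases "x cs = 0")
      case False
      then have "cs \<in> box n K" using assms(2) by (auto simp: free_space_def)
      then have "(\<Prod>j<n. matrix_on (K j) (snd (fs ! j)) (cs' ! j) (cs ! j))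
          = (\<Prod>j<n. snd (fs ! j) (delta (cs ! j)) (cs' ! j))"
        by (intro prod.cong) (auto simp: box_def matrix_on_def)
      then show ?thesis
        using len assms(1) by (simp add: tensor_def)
    qed simp
  qed
  also have "\<dots> = (if length cs' = n
    then \<Sum>cs | length cs = n. koszul_sign (map fst fs) (map dim cs) *
      (\<Prod>j<n. matrix_on (K j) (snd (fs ! j)) (cs' ! j) (cs ! j)) * x cs else 0)"
    by simp
  finally show "tensor_map fs x cs' = \<dots>" .
qed

lemma tensor_map_even:
  assumes "length fs = n" and "x \<in> free_space (box n K)"
    and "\<And>j. j < n \<Longrightarrow> fst (fs ! j) = 0"
  shows "tensor_map fs x = tensor_matrix n (\<lambda>j. matrix_on (K j) (snd (fs ! j))) x"
proof -
  have *: "koszul_sign (map fst fs) ds = 1" for ds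
    using assms by (intro koszul_sign_even) auto
  show ?thesis
    unfolding tensor_map_apply[OF assms(1,2)] tensor_matrix_def * mult_1_left by (rule refl)
qed

lemma tensor_map_odd:
  assumes "length fs = n" and "x \<in> free_space (box n K)" and "m < n" and "odd (fst (fs ! m))"
    and "\<And>j. j < n \<Longrightarrow> j \<noteq> m \<Longrightarrow> fst (fs ! j) = 0"
  shows "tensor_map fs x = koszul_map n m (\<lambda>j. matrix_on (K j) (snd (fs ! j))) x"
proof -
  have "koszul_sign (map fst fs) (map dim cs) = (\<Prod>i<n. if i < m then parity (cs ! i) else 1)"
    if "length cs = n" for cs
  proof -
    have "koszul_sign (map fst fs) (map dim cs)
        = (\<Prod>i<n. if i < m then (-1) powi (map dim cs ! i) else 1)"
      using assms that by (intro koszul_sign_single) auto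
    also have "\<dots> = (\<Prod>i<n. if i < m then parity (cs ! i) else 1)"
      using that by (intro prod.cong) (auto simp: parity_def)
    finally show ?thesis .
  qed
  then show ?thesis
    unfolding tensor_map_apply[OF assms(1,2)] koszul_map_def tensor_matrix_def
    by (auto simp: fun_eq_iff twist_def prod.distrib intro!: sum.cong)
qed

section \<open>Differentials and tensor powers in matrix form\<close>

definition differential_factor ::
  "(nat \<Rightarrow> cell set) \<Rightarrow> (nat \<Rightarrow> cell_matrix) \<Rightarrow> nat \<Rightarrow> nat \<Rightarrow> cell_matrix" where
  "differential_factor K D l j = (if j = l then D j else idm (K j))"

lemma tensor_differential_eq:
  assumes "length ds = n" and "x \<in> free_space (box n K)" and "odd s"
  shows "tensor_differential s ds x =
    (\<Sum>l<n. koszul_map n l (differential_factor K (\<lambda>j. matrix_on (K j) (ds ! j)) l) x)"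
  unfolding tensor_differential_def assms(1)
proof (rule sum.cong[OF refl])
  fix l assume "l \<in> {..<n}"
  then have l: "l < n" by simp
  have "tensor_map ((replicate n (0, id))[l := (s, ds ! l)]) x
    = koszul_map n l (\<lambda>j. matrix_on (K j) (snd ((replicate n (0, id))[l := (s, ds ! l)] ! j))) x"
    using assms l by (intro tensor_map_odd) auto
  also have "\<dots> = koszul_map n l (differential_factor K (\<lambda>j. matrix_on (K j) (ds ! j)) l) x"
    using l by (intro koszul_map_cong) (auto simp: differential_factor_def)
  finally show "tensor_map ((replicate n (0, id))[l := (s, ds ! l)]) x
    = koszul_map n l (differential_factor K (\<lambda>j. matrix_on (K j) (ds ! j)) l) x" .
qed

lemma boundary_eq:
  assumes "length Ks = n" and "x \<in> free_space (box n K)"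
  shows "boundary Ks x = (\<Sum>l<n. koszul_map n l (differential_factor K (\<lambda>j. bdm (K j)) l) x)"
  unfolding boundary_def
  using assms by (subst tensor_differential_eq[where n = n and K = K])
    (auto intro!: sum.cong koszul_map_cong simp: differential_factor_def)

lemma coboundary_eq:
  assumes "length Ks = n" and "x \<in> free_space (box n K)" and "\<And>j. j < n \<Longrightarrow> Ks ! j = K j"
  shows "coboundary Ks x =
    (\<Sum>l<n. koszul_map n l (differential_factor K (\<lambda>j. matrix_on (K j) (coboundary1 (K j))) l) x)"
  unfolding coboundary_def
  using assms by (subst tensor_differential_eq[where n = n and K = K])
    (auto intro!: sum.cong koszul_map_cong simp: differential_factor_def)

lemma tensor_power_id_eq:
  assumes "k \<le> n" and "x \<in> free_space (box n K)"
  shows "tensor_power_id f k n x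
    = tensor_matrix n (\<lambda>j. if j < k then matrix_on (K j) f else idm (K j)) x"
proof -
  have "tensor_power_id f k n x = tensor_matrix n
      (\<lambda>j. matrix_on (K j) (snd ((replicate k (0::int, f) @ replicate (n - k) (0, id)) ! j))) x"
    unfolding tensor_power_id_def using assms by (intro tensor_map_even) (auto simp: nth_append)
  also have "\<dots> = tensor_matrix n (\<lambda>j. if j < k then matrix_on (K j) f else idm (K j)) x"
    using assms by (intro tensor_matrix_cong) (auto simp: nth_append)
  finally show ?thesis .
qed

section \<open>The permutation action\<close>

lemma permute_list_inv:
  assumes "\<sigma> permutes {..<length cs}"
  shows "permute_list \<sigma> (permute_list (inv \<sigma>) cs) = cs"
    and "permute_list (inv \<sigma>) (permute_list \<sigma> cs) = cs"
  using permute_list_compose[OF assms, of "inv \<sigma>"]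
    permute_list_compose[OF permutes_inv[OF assms], of \<sigma>] permutes_inv_o[OF assms]
  by simp_all

text \<open>\<open>permute_list \<sigma> cs'\<close> is the only list that the action sends to a
  multiple of \<open>cs'\<close>. So the action is a pullback along \<sigma>, carrying the sign of
  the source list, although its definition pushes forward with \<open>inv \<sigma>\<close>.\<close>

lemma tensor_perm_apply:
  assumes "\<sigma> permutes {..<n}" and "x \<in> free_space (box n K)"
  shows "tensor_perm \<sigma> x = (\<lambda>cs'. if length cs' = n
    then perm_sign \<sigma> (map dim (permute_list \<sigma> cs')) * x (permute_list \<sigma> cs') else 0)"
proof
  fix cs'
  let ?t = "\<lambda>cs. x cs * (perm_sign \<sigma> (map dim cs) * delta (permute_list (inv \<sigma>) cs) cs')"
  have "tensor_perm \<sigma> x cs' = (\<Sum>cs | x cs \<noteq> 0. ?t cs)"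
    by (simp add: tensor_perm_def lin_ext_def sum_fun_apply scale_def)
  also have "\<dots> = (\<Sum>cs | length cs = n. ?t cs)"
    using assms(2) by (intro sum.mono_neutral_left) (auto simp: free_space_def box_def)
  also have "\<dots> = (\<Sum>cs | length cs = n. if cs = permute_list \<sigma> cs' then
      perm_sign \<sigma> (map dim (permute_list \<sigma> cs')) * x (permute_list \<sigma> cs') else 0)"
  proof (rule sum.cong[OF refl])
    fix cs :: "cell list" assume "cs \<in> {cs. length cs = n}"
    then have "length cs = n" by simp
    then have "cs' = permute_list (inv \<sigma>) cs \<longleftrightarrow> cs = permute_list \<sigma> cs'"
      using assms(1) permute_list_inv[of \<sigma> cs] permute_list_inv[of \<sigma> cs'] by (metis length_permute_list)
    then show "?t cs = (if cs = permute_list \<sigma> cs' then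
      perm_sign \<sigma> (map dim (permute_list \<sigma> cs')) * x (permute_list \<sigma> cs') else 0)"
      by (auto simp: delta_def)
  qed
  also have "\<dots> = (if length cs' = n
    then perm_sign \<sigma> (map dim (permute_list \<sigma> cs')) * x (permute_list \<sigma> cs') else 0)"
    by (simp add: sum.delta)
  finally show "tensor_perm \<sigma> x cs' = \<dots>" .
qed

lemma powi_square: "((-1) powi d :: real) * (-1) powi d = 1"
  by (simp add: power_int_minus_left)

lemma perm_sign_square: "perm_sign \<sigma> ds * perm_sign \<sigma> ds = 1"
  unfolding perm_sign_def prod.distrib[symmetric]
  by (intro prod.neutral) (auto simp: powi_square)

text \<open>
  Changing the parity of the entry at \<open>m\<close> changes the sign of \<open>\<sigma>\<close> by the parities of the
  entries whose order relative to \<open>m\<close> is reversed by \<open>\<sigma>\<close>.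
\<close>

lemma perm_sign_shift:
  assumes \<sigma>: "\<sigma> permutes {..<n}" and "m < n" "odd r" "length ds = n" "length ds' = n"
    and ds': "\<And>i. i < n \<Longrightarrow> ds' ! i = ds ! i + (if i = m then r else 0)"
  shows "perm_sign \<sigma> ds' * (\<Prod>i<n. if i < m then (-1) powi (ds ! i) else 1)
    = perm_sign \<sigma> ds * (\<Prod>i<n. if \<sigma> i < \<sigma> m then (-1) powi (ds ! i) else 1)"
proof -
  define I where "I = {(i, j). i < j \<and> j < n \<and> \<sigma> j < \<sigma> i}"
  define e :: "nat \<Rightarrow> real" where "e i = (-1) powi (ds ! i)" for i
  \<comment> \<open>\<open>t\<close> is the change in the sign of an inversion when the odd number
    \<open>r\<close> is added at \<open>m\<close>: the products (d_m + r) d_j and d_m d_j differ in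
    parity exactly when d_j is odd.\<close>
  define t where "t = (\<lambda>(i, j). if i = m then e j else if j = m then e i else 1)"
  define R where "R = {i. i < n \<and> (i < m) \<noteq> (\<sigma> i < \<sigma> m)}"
  have fin: "finite I"
    by (rule finite_subset[of _ "{..<n} \<times> {..<n}"]) (auto simp: I_def)
  have ps: "perm_sign \<sigma> ds = (\<Prod>(i, j)\<in>I. (-1) powi (ds ! i * ds ! j))"
    "perm_sign \<sigma> ds' = (\<Prod>(i, j)\<in>I. (-1) powi (ds' ! i * ds' ! j))"
    using assms by (simp_all add: perm_sign_def I_def)
  have "perm_sign \<sigma> ds' = (\<Prod>p\<in>I. (case p of (i, j) \<Rightarrow> (-1) powi (ds ! i * ds ! j)) * t p)"
    unfolding ps
  proof (rule prod.cong[OF refl], clarify)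
    fix i j assume "(i, j) \<in> I"
    then have "i < n" "j < n" "i \<noteq> j" by (auto simp: I_def)
    then show "(-1 :: real) powi (ds' ! i * ds' ! j) = (-1) powi (ds ! i * ds ! j) * t (i, j)"
      using \<open>odd r\<close> by (auto simp: ds' t_def e_def power_int_minus_left)
  qed
  then have 1: "perm_sign \<sigma> ds' = perm_sign \<sigma> ds * prod t I"
    by (simp add: prod.distrib ps)
  have inj: "\<sigma> i = \<sigma> m \<longleftrightarrow> i = m" for i
    using permutes_inj[OF \<sigma>] by (auto dest: injD)
  have "prod t I = prod t {p \<in> I. fst p = m \<or> snd p = m}"
    by (rule prod.mono_neutral_right[OF fin]) (auto simp: t_def split: if_splits)
  also have "\<dots> = prod e R"
  \<comment> \<open>An inversion containing \<open>m\<close> is determined by its other member, and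
    these members are exactly the elements of \<open>R\<close>.\<close>
  proof (rule prod.reindex_bij_witness[where i = "\<lambda>i. if i < m then (i, m) else (m, i)"
          and j = "\<lambda>p. if fst p = m then snd p else fst p"])
    fix p assume "p \<in> {p \<in> I. fst p = m \<or> snd p = m}"
    then obtain i j where p: "p = (i, j)" "i < j" "j < n" "\<sigma> j < \<sigma> i" "i = m \<or> j = m"
      by (auto simp: I_def)
    then show "(if (if fst p = m then snd p else fst p) < m
        then (if fst p = m then snd p else fst p, m)
        else (m, if fst p = m then snd p else fst p)) = p"
      and "(if fst p = m then snd p else fst p) \<in> R"
      and "e (if fst p = m then snd p else fst p) = t p"
      by (auto simp: R_def t_def)
  next
    fix i assume "i \<in> R"
    then have "i < n" "i < m \<and> \<sigma> m < \<sigma> i \<or> m < i \<and> \<sigma> i < \<sigma> m"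
      using inj[of i] by (auto simp: R_def)
    then show "(if fst (if i < m then (i, m) else (m, i)) = m
        then snd (if i < m then (i, m) else (m, i)) else fst (if i < m then (i, m) else (m, i))) = i"
      and "(if i < m then (i, m) else (m, i)) \<in> {p \<in> I. fst p = m \<or> snd p = m}"
      using \<open>m < n\<close> by (auto simp: I_def)
  qed
  also have "\<dots> = (\<Prod>i<n. if (i < m) \<noteq> (\<sigma> i < \<sigma> m) then e i else 1)"
    by (rule prod.mono_neutral_cong_left) (auto simp: R_def)
  finally have 2: "prod t I = \<dots>" .
  \<comment> \<open>The slots before \<open>m\<close> and the slots whose order relative to
    \<open>m\<close> is reversed have as symmetric difference the slots that \<sigma> puts before
    \<open>\<sigma> m\<close>; signs occurring twice cancel.\<close>
  have "(\<Prod>i<n. if (i < m) \<noteq> (\<sigma> i < \<sigma> m) then e i else 1) * (\<Prod>i<n. if i < m then e i else 1)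
      = (\<Prod>i<n. if \<sigma> i < \<sigma> m then e i else 1)"
    unfolding prod.distrib[symmetric] by (intro prod.cong) (auto simp: e_def powi_square)
  then show ?thesis
    unfolding 1 2 e_def[symmetric] by (simp add: mult.assoc)
qed

lemma permute_list_in_box:
  assumes "\<sigma> permutes {..<n}" and "\<And>j. j < n \<Longrightarrow> K (\<sigma> j) = K j" and "length cs = n"
  shows "permute_list \<sigma> cs \<in> box n K \<longleftrightarrow> cs \<in> box n K"
proof -
  have "(\<forall>j<n. cs ! \<sigma> j \<in> K j) \<longleftrightarrow> (\<forall>j<n. cs ! j \<in> K j)"
  proof -
    have "(\<forall>j<n. cs ! \<sigma> j \<in> K j) \<longleftrightarrow> (\<forall>j\<in>{..<n}. cs ! \<sigma> j \<in> K (\<sigma> j))"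
      using assms(2) by auto
    also have "\<dots> \<longleftrightarrow> (\<forall>j\<in>\<sigma> ` {..<n}. cs ! j \<in> K j)" by blast
    finally show ?thesis by (simp add: permutes_image[OF assms(1)] Ball_def)
  qed
  then show ?thesis
    using assms by (simp add: box_def permute_list_nth)
qed

lemma tensor_perm_surj:
  assumes \<sigma>: "\<sigma> permutes {..<n}" and K: "\<And>j. j < n \<Longrightarrow> K (\<sigma> j) = K j"
    and x: "x \<in> free_space (box n K)"
  shows "\<exists>y \<in> free_space (box n K). tensor_perm \<sigma> y = x"
proof
  \<comment> \<open>The sign squares to one, so the same sign serves for the inverse.\<close>
  define y where "y = (\<lambda>cs. if length cs = n
    then perm_sign \<sigma> (map dim cs) * x (permute_list (inv \<sigma>) cs) else 0)"
  show y: "y \<in> free_space (box n K)"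
    unfolding free_space_def
  proof (clarify)
    fix cs assume "y cs \<noteq> 0"
    then have len: "length cs = n" and "permute_list (inv \<sigma>) cs \<in> box n K"
      using x by (auto simp: y_def free_space_def split: if_splits)
    then show "cs \<in> box n K"
      using permute_list_in_box[of \<sigma> n K "permute_list (inv \<sigma>) cs"] K permute_list_inv[of \<sigma> cs] \<sigma>
      by simp
  qed
  show "tensor_perm \<sigma> y = x"
  proof
    fix cs
    show "tensor_perm \<sigma> y cs = x cs"
    proof (cases "length cs = n")
      case True
      then show ?thesis
        unfolding tensor_perm_apply[OF \<sigma> y] using permute_list_inv[of \<sigma> cs] \<sigma>
        by (simp add: y_def perm_sign_square mult.assoc[symmetric])
    next
      case False
      then show ?thesis
        using x by (auto simp: tensor_perm_apply[OF \<sigma> y] free_space_def box_def)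
    qed
  qed
qed

text \<open>Conjugation is stated as an intertwining relation, which avoids the inverse of the
  action. Reindexing by \<sigma> matches the unsigned factors; \<open>perm_sign_shift\<close> trades
  the twist before \<open>m\<close> in the old order for the twist before \<open>\<sigma> m\<close>
  in the new one.\<close>

lemma tensor_perm_koszul_map:
  assumes \<sigma>: "\<sigma> permutes {..<n}" and "m < n" "odd r"
    and hom: "\<And>j. j < n \<Longrightarrow> homogeneous (K j) (L j) (if j = m then r else 0) (F j)"
    and y: "y \<in> free_space (box n K)"
  shows "tensor_perm \<sigma> (koszul_map n m F y)
    = koszul_map n (\<sigma> m) (\<lambda>j. F (inv \<sigma> j)) (tensor_perm \<sigma> y)"
proof
  fix cs'
  have Fy: "koszul_map n m F y \<in> free_space (box n L)"
    using koszul_map_graded[of n K L m r F, OF hom \<open>m < n\<close>] y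
    by (auto simp: graded_map_def linear_between_def)
  show "tensor_perm \<sigma> (koszul_map n m F y) cs'
    = koszul_map n (\<sigma> m) (\<lambda>j. F (inv \<sigma> j)) (tensor_perm \<sigma> y) cs'"
  proof (cases "length cs' = n")
    case len': True
    define bs where "bs = permute_list \<sigma> cs'"
    \<comment> \<open>The twist of the right-hand side expressed in source positions: the slots that
      \<sigma> moves in front of \<open>\<sigma> m\<close>.\<close>
    define S where "S = (\<lambda>cs. \<Prod>j<n. if \<sigma> j < \<sigma> m then parity (cs ! j) else 1)"
    have bs: "length bs = n" "\<And>j. j < n \<Longrightarrow> bs ! j = cs' ! \<sigma> j"
      using len' \<sigma> by (simp_all add: bs_def permute_list_nth)
    have factor: "(\<Prod>j<n. twist (\<sigma> m) (\<lambda>j. F (inv \<sigma> j)) j (cs' ! j) (ds ! j))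
        = S (permute_list \<sigma> ds) * (\<Prod>j<n. F j (bs ! j) (permute_list \<sigma> ds ! j))" if "length ds = n" for ds
    proof -
      have "(\<Prod>j<n. twist (\<sigma> m) (\<lambda>j. F (inv \<sigma> j)) j (cs' ! j) (ds ! j))
          = (\<Prod>j<n. twist (\<sigma> m) (\<lambda>j. F (inv \<sigma> j)) (\<sigma> j) (cs' ! \<sigma> j) (ds ! \<sigma> j))"
        using prod.permute[OF \<sigma>, of "\<lambda>j. twist (\<sigma> m) (\<lambda>j. F (inv \<sigma> j)) j (cs' ! j) (ds ! j)"]
        by (simp add: comp_def)
      also have "\<dots> = (\<Prod>j<n. (if \<sigma> j < \<sigma> m then parity (permute_list \<sigma> ds ! j) else 1)
          * F j (bs ! j) (permute_list \<sigma> ds ! j))"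
        using that \<sigma>
        by (intro prod.cong)
          (auto simp: twist_def permute_list_nth bs permutes_inverses[OF \<sigma>])
      finally show ?thesis by (simp only: prod.distrib S_def)
    qed
    \<comment> \<open>If all entries are nonzero, homogeneity makes the degrees of \<open>bs\<close>
      and \<open>cs\<close> differ by \<open>r\<close> at \<open>m\<close> only, as
      \<open>perm_sign_shift\<close> requires; otherwise both sides vanish.\<close>
    have sign: "perm_sign \<sigma> (map dim bs) * (\<Prod>j<n. twist m F j (bs ! j) (cs ! j))
        = S cs * (\<Prod>j<n. F j (bs ! j) (cs ! j)) * perm_sign \<sigma> (map dim cs)" if len: "length cs = n" for cs
    proof (cases "(\<Prod>j<n. F j (bs ! j) (cs ! j)) = 0")
      case True
      then show ?thesis by (simp add: twist_def prod.distrib)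
    next
      case False
      then have "dim (bs ! j) = dim (cs ! j) + (if j = m then r else 0)" if "j < n" for j
        using hom[OF that] that unfolding homogeneous_def by (metis finite_lessThan lessThan_iff prod_zero)
      then have "perm_sign \<sigma> (map dim bs) * (\<Prod>i<n. if i < m then (-1) powi (map dim cs ! i) else 1)
        = perm_sign \<sigma> (map dim cs) * (\<Prod>i<n. if \<sigma> i < \<sigma> m then (-1) powi (map dim cs ! i) else 1)"
        using len bs(1) by (intro perm_sign_shift[OF \<sigma> \<open>m < n\<close> \<open>odd r\<close>]) auto
      moreover have "(\<Prod>i<n. if Q i then (-1) powi (map dim cs ! i) else 1)
          = (\<Prod>i<n. if Q i then parity (cs ! i) else 1)" for Q
        using len by (intro prod.cong) (auto simp: parity_def)
      ultimately show ?thesis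
        by (simp add: S_def twist_def prod.distrib mult.assoc[symmetric])
    qed
    have "tensor_perm \<sigma> (koszul_map n m F y) cs'
        = (\<Sum>cs | length cs = n. perm_sign \<sigma> (map dim bs)
            * (\<Prod>j<n. twist m F j (bs ! j) (cs ! j)) * y cs)"
      unfolding tensor_perm_apply[OF \<sigma> Fy] using len' bs(1)
      by (simp add: bs_def[symmetric] koszul_map_def tensor_matrix_def sum_distrib_left mult.assoc)
    also have "\<dots> = (\<Sum>ds | length ds = n.
        (\<Prod>j<n. twist (\<sigma> m) (\<lambda>j. F (inv \<sigma> j)) j (cs' ! j) (ds ! j))
        * (perm_sign \<sigma> (map dim (permute_list \<sigma> ds)) * y (permute_list \<sigma> ds)))"
      using \<sigma>
      by (intro sum.reindex_bij_witness[where i = "permute_list \<sigma>" and j = "permute_list (inv \<sigma>)"])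
        (auto simp: permute_list_inv factor sign mult.assoc)
    also have "\<dots> = koszul_map n (\<sigma> m) (\<lambda>j. F (inv \<sigma> j)) (tensor_perm \<sigma> y) cs'"
      unfolding tensor_perm_apply[OF \<sigma> y] using len' by (simp add: koszul_map_def tensor_matrix_def)
    finally show ?thesis .
  next
    case False
    then show ?thesis
      unfolding tensor_perm_apply[OF \<sigma> Fy] by (simp add: koszul_map_def tensor_matrix_def)
  qed
qed

section \<open>The cubical homotopy as an average of Koszul maps\<close>

definition homotopy_factor ::
  "cell_matrix \<Rightarrow> cell_matrix \<Rightarrow> nat \<Rightarrow> nat \<Rightarrow> nat \<Rightarrow> cell_matrix" where
  "homotopy_factor A P k j l =
     (if l = j then A else if j < l \<and> l < k then P else idm (star_factor k l))"

text \<open>The weld homotopy after the conjugation has been carried out: slot \<open>l\<close>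
  holds the factor that stood at \<open>inv \<sigma> l\<close>, the odd factor has moved to
  \<open>\<sigma> j\<close>, and no permutation operator is left.\<close>

definition symmetrized_homotopy ::
  "cell_matrix \<Rightarrow> cell_matrix \<Rightarrow> nat \<Rightarrow> nat \<Rightarrow> cell list vec \<Rightarrow> cell list vec" where
  "symmetrized_homotopy A P k n x = (1 / fact k) *\<^sub>v (\<Sum>\<sigma> | \<sigma> permutes {..<k}.
     \<Sum>j<k. koszul_map n (\<sigma> j) (\<lambda>l. homotopy_factor A P k j (inv \<sigma> l)) x)"

lemma homogeneous_homotopy_factor:
  assumes "homogeneous star_interval star_interval r A"
    and "homogeneous star_interval star_interval 0 P" and "j < k"
  shows "homogeneous (star_factor k l) (star_factor k l) (if l = j then r else 0)
    (homotopy_factor A P k j l)"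
  using assms homogeneous_maps(1) by (auto simp: homotopy_factor_def star_factor_def)

text \<open>\<open>tensor_perm\<close> is a linear extension over the infinite type of lists, so
  additivity is taken from its closed form on chains supported in a box.\<close>

lemma tensor_perm_sum:
  assumes "\<sigma> permutes {..<n}" and "finite J" and "\<And>j. j \<in> J \<Longrightarrow> f j \<in> free_space (box n K)"
  shows "tensor_perm \<sigma> (\<Sum>j\<in>J. f j) = (\<Sum>j\<in>J. tensor_perm \<sigma> (f j))"
proof -
  have "(\<Sum>j\<in>J. f j) \<in> free_space (box n K)"
    unfolding free_space_def sum_fun_apply
    using assms(3) by (auto simp: free_space_def elim!: sum.not_neutral_contains_not_neutral)
  note tau = tensor_perm_apply[OF assms(1) this] tensor_perm_apply[OF assms(1) assms(3)]
  show ?thesis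
    by (auto simp: tau(1) fun_eq_iff sum_fun_apply sum_distrib_left tau(2) intro!: sum.cong)
qed

text \<open>The summands of the weld homotopy are numbered from 1, those of
  \<open>homotopy_factor\<close> from 0; hence \<open>Suc j\<close>.\<close>

lemma weld_homotopy_term_eq:
  assumes "j < k" "k \<le> n" "odd r" and "x \<in> free_space (box n (star_factor k))"
  shows "weld_homotopy_term r a i p k n (Suc j) x = koszul_map n j
    (homotopy_factor (matrix_on star_interval a) (matrix_on star_interval (i \<circ> p)) k j) x"
proof -
  let ?fs = "replicate j (0, id) @ [(r, a)] @ replicate (k - Suc j) (0, i \<circ> p) @ replicate (n - k) (0, id)"
  have "weld_homotopy_term r a i p k n (Suc j) x
      = koszul_map n j (\<lambda>l. matrix_on (star_factor k l) (snd (?fs ! l))) x"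
    unfolding weld_homotopy_term_def diff_Suc_1 using assms
    by (intro tensor_map_odd) (auto simp: nth_append nth_Cons')
  also have "\<dots> = koszul_map n j
      (homotopy_factor (matrix_on star_interval a) (matrix_on star_interval (i \<circ> p)) k j) x"
    using assms
    by (intro koszul_map_cong) (auto simp: homotopy_factor_def star_factor_def nth_append nth_Cons')
  finally show ?thesis .
qed

lemma star_factor_permutes:
  "\<sigma> permutes {..<k} \<Longrightarrow> star_factor k (\<sigma> j) = star_factor k j"
  using permutes_in_image[of \<sigma> "{..<k}" j] by (auto simp: star_factor_def)

text \<open>The \<open>inv_into\<close> is never computed. Surjectivity of the action on the star
  cube makes it a true preimage \<open>y\<close> of \<open>x\<close>; intertwining then moves the
  action onto \<open>y\<close>, where it gives back \<open>x\<close>.\<close>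

lemma weld_homotopy_eq:
  fixes a i p :: "cell vec \<Rightarrow> cell vec"
  defines "A \<equiv> matrix_on star_interval a" and "P \<equiv> matrix_on star_interval (i \<circ> p)"
  assumes "k \<le> n" "odd r" and x: "x \<in> free_space (star_cube k n)"
    and A: "homogeneous star_interval star_interval r A"
    and P: "homogeneous star_interval star_interval 0 P"
  shows "weld_homotopy r a i p k n x = symmetrized_homotopy A P k n x"
  unfolding weld_homotopy_def symmetrized_homotopy_def
proof (intro arg_cong[where f = "\<lambda>y. _ *\<^sub>v y"] sum.cong refl)
  fix \<sigma> assume "\<sigma> \<in> {\<sigma>. \<sigma> permutes {..<k}}"
  then have \<sigma>k: "\<sigma> permutes {..<k}" by simp
  then have \<sigma>: "\<sigma> permutes {..<n}"
    using \<open>k \<le> n\<close> by (auto elim: permutes_subset)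
  let ?X = "free_space (box n (star_factor k))"
  define y where "y = inv_into (free_space (star_cube k n)) (tensor_perm \<sigma>) x"
  have "x \<in> tensor_perm \<sigma> ` ?X"
    using tensor_perm_surj[OF \<sigma>, of "star_factor k" x] x star_factor_permutes[OF \<sigma>k]
    by (auto simp: star_cube_eq_box[OF \<open>k \<le> n\<close>])
  then have y: "y \<in> ?X" and yx: "tensor_perm \<sigma> y = x"
    unfolding y_def star_cube_eq_box[OF \<open>k \<le> n\<close>] by (rule inv_into_into, rule f_inv_into_f)
  have hom: "homogeneous (star_factor k l) (star_factor k l) (if l = j then r else 0)
    (homotopy_factor A P k j l)" if "j < k" for j l
    using homogeneous_homotopy_factor[OF A P that] .
  have "(\<Sum>j=1..k. weld_homotopy_term r a i p k n j y)
      = (\<Sum>j<k. weld_homotopy_term r a i p k n (Suc j) y)"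
    by (rule sum.reindex_bij_witness[where i = Suc and j = "\<lambda>j. j - 1"]) auto
  also have "\<dots> = (\<Sum>j<k. koszul_map n j (homotopy_factor A P k j) y)"
    unfolding A_def P_def
    using y \<open>k \<le> n\<close> \<open>odd r\<close> by (intro sum.cong refl weld_homotopy_term_eq) auto
  finally have "tensor_perm \<sigma> (\<Sum>j=1..k. weld_homotopy_term r a i p k n j y)
      = tensor_perm \<sigma> (\<Sum>j<k. koszul_map n j (homotopy_factor A P k j) y)" by simp
  also have "\<dots> = (\<Sum>j<k. tensor_perm \<sigma> (koszul_map n j (homotopy_factor A P k j) y))"
  proof (rule tensor_perm_sum[OF \<sigma>, where K = "star_factor k"])
    fix j assume "j \<in> {..<k}"
    then show "koszul_map n j (homotopy_factor A P k j) y \<in> ?X"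
      using koszul_map_graded[of n "star_factor k" "star_factor k" j r "homotopy_factor A P k j"]
        hom y \<open>k \<le> n\<close> by (auto simp: graded_map_def linear_between_def)
  qed simp
  also have "\<dots> = (\<Sum>j<k. koszul_map n (\<sigma> j) (\<lambda>l. homotopy_factor A P k j (inv \<sigma> l)) x)"
    using hom \<open>k \<le> n\<close> by (intro sum.cong refl)
      (simp add: tensor_perm_koszul_map[OF \<sigma> _ \<open>odd r\<close> hom y] yx)
  finally show "tensor_perm \<sigma> (\<Sum>j=1..k. weld_homotopy_term r a i p k n j
      (inv_into (free_space (star_cube k n)) (tensor_perm \<sigma>) x))
    = (\<Sum>j<k. koszul_map n (\<sigma> j) (\<lambda>l. homotopy_factor A P k j (inv \<sigma> l)) x)"
    by (simp add: y_def)
qed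

section \<open>Closure properties of graded maps\<close>

lemma free_space_0: "0 \<in> free_space X"
  by (simp add: free_space_def)

lemma free_space_sum:
  "(\<And>i. i \<in> I \<Longrightarrow> f i \<in> free_space X) \<Longrightarrow> (\<Sum>i\<in>I. f i) \<in> free_space X"
  unfolding free_space_def sum_fun_apply
  by (auto elim!: sum.not_neutral_contains_not_neutral)

lemma free_space_scale: "x \<in> free_space X \<Longrightarrow> r *\<^sub>v x \<in> free_space X"
  by (auto simp: free_space_def scale_def)

lemma scale_sum: "r *\<^sub>v (\<Sum>i\<in>I. f i) = (\<Sum>i\<in>I. r *\<^sub>v f i)"
  by (simp add: fun_eq_iff sum_fun_apply scale_def sum_distrib_left)

lemma scale_add: "r *\<^sub>v (x + y) = r *\<^sub>v x + r *\<^sub>v y"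
  by (simp add: fun_eq_iff scale_def algebra_simps)

lemma scale_scale: "r *\<^sub>v s *\<^sub>v x = (r * s) *\<^sub>v x"
  by (simp add: fun_eq_iff scale_def)

lemma scale_0: "r *\<^sub>v 0 = 0"
  by (simp add: fun_eq_iff scale_def)

lemma graded_map_in_space: "graded_map dg X Y r f \<Longrightarrow> x \<in> free_space X \<Longrightarrow> f x \<in> free_space Y"
  by (simp add: graded_map_def linear_between_def)

lemma graded_map_sum:
  assumes "\<And>i. i \<in> I \<Longrightarrow> graded_map dg X Y r (f i)"
  shows "graded_map dg X Y r (\<lambda>x. \<Sum>i\<in>I. f i x)"
  unfolding graded_map_def linear_between_def graded_piece_def
proof (intro conjI ballI allI)
  fix x y s
  assume x: "x \<in> free_space X"
  show "(\<Sum>i\<in>I. f i x) \<in> free_space Y"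
    using assms x by (intro free_space_sum) (auto simp: graded_map_def linear_between_def)
  show "(\<Sum>i\<in>I. f i (s *\<^sub>v x)) = s *\<^sub>v (\<Sum>i\<in>I. f i x)"
    unfolding scale_sum using assms x
    by (intro sum.cong) (auto simp: graded_map_def linear_between_def)
  assume y: "y \<in> free_space X"
  show "(\<Sum>i\<in>I. f i (x + y)) = (\<Sum>i\<in>I. f i x) + (\<Sum>i\<in>I. f i y)"
    unfolding sum.distrib[symmetric] using assms x y
    by (intro sum.cong) (auto simp: graded_map_def linear_between_def)
next
  fix q x assume "x \<in> free_space {c \<in> X. dg c = q}"
  then show "(\<Sum>i\<in>I. f i x) \<in> free_space {c \<in> Y. dg c = q + r}"
    using assms by (intro free_space_sum) (auto simp: graded_map_def graded_piece_def)
qed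

lemma graded_map_scale:
  assumes "graded_map dg X Y r f"
  shows "graded_map dg X Y r (\<lambda>x. t *\<^sub>v f x)"
  using assms unfolding graded_map_def linear_between_def graded_piece_def
  by (auto simp: scale_add scale_scale mult.commute free_space_scale)

lemma graded_piece_subset: "graded_piece dg X q \<subseteq> free_space X"
  by (auto simp: graded_piece_def free_space_def)

lemma free_space_add: "x \<in> free_space X \<Longrightarrow> y \<in> free_space X \<Longrightarrow> x + y \<in> free_space X"
  by (auto simp: free_space_def) (metis add_0)

lemma graded_map_cong:
  assumes "graded_map dg X Y r f" and "\<And>x. x \<in> free_space X \<Longrightarrow> f' x = f x"
  shows "graded_map dg X Y r f'"
proof -
  have "f' x = f x" if "x \<in> graded_piece dg X q" for x q
    using assms(2) that graded_piece_subset by blast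
  then show ?thesis
    using assms by (simp add: graded_map_def linear_between_def free_space_add free_space_scale)
qed

text \<open>The maps of the theorem are identified with their matrix forms on chains of the cubes
  only. That suffices, since every condition is quantified over these chains and the maps preserve
  them.\<close>

lemma special_deformation_retraction_cong:
  assumes sdr: "special_deformation_retraction dg s X dX Y dY i p a"
    and eq: "\<And>x. x \<in> free_space X \<Longrightarrow> dX' x = dX x" "\<And>y. y \<in> free_space Y \<Longrightarrow> dY' y = dY y"
      "\<And>y. y \<in> free_space Y \<Longrightarrow> i' y = i y" "\<And>x. x \<in> free_space X \<Longrightarrow> p' x = p x"
      "\<And>x. x \<in> free_space X \<Longrightarrow> a' x = a x"
  shows "special_deformation_retraction dg s X dX' Y dY' i' p' a'"
proof -
  have gr: "graded_map dg X X s dX" "graded_map dg Y Y s dY" "graded_map dg Y X 0 i"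
    "graded_map dg X Y 0 p" "graded_map dg X X (- s) a"
    using sdr by (auto simp: special_deformation_retraction_def is_complex_def is_complex_map_def)
  have "graded_map dg X X s dX'" "graded_map dg Y Y s dY'" "graded_map dg Y X 0 i'"
    "graded_map dg X Y 0 p'" "graded_map dg X X (- s) a'"
    using gr[THEN graded_map_cong] eq by blast+
  then show ?thesis
    using sdr gr[THEN graded_map_in_space]
    by (simp add: special_deformation_retraction_def is_complex_def is_complex_map_def eq)
qed

section \<open>Transposition\<close>

lemma pairing_eq:
  assumes "finite X" and "x \<in> free_space X"
  shows "pairing \<alpha> x = (\<Sum>c\<in>X. \<alpha> c * x c)"
  unfolding pairing_def using assms
  by (intro sum.mono_neutral_left) (auto simp: free_space_def)

lemma is_transpose_in_space: "is_transpose X Y f g \<Longrightarrow> \<alpha> \<in> free_space Y \<Longrightarrow> g \<alpha> \<in> free_space X"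
  by (simp add: is_transpose_def)

lemma is_transpose_pairing:
  "is_transpose X Y f g \<Longrightarrow> \<alpha> \<in> free_space Y \<Longrightarrow> x \<in> free_space X \<Longrightarrow>
    pairing (g \<alpha>) x = pairing \<alpha> (f x)"
  by (simp add: is_transpose_def)

lemma is_transpose_cong:
  assumes "is_transpose X Y f g"
    and "\<And>x. x \<in> free_space X \<Longrightarrow> f' x = f x" and "\<And>\<alpha>. \<alpha> \<in> free_space Y \<Longrightarrow> g' \<alpha> = g \<alpha>"
  shows "is_transpose X Y f' g'"
  using assms by (simp add: is_transpose_def)

lemma is_transpose_sum:
  assumes "finite X" "finite Y"
    and "\<And>i. i \<in> I \<Longrightarrow> is_transpose X Y (f i) (g i)"
    and "\<And>i x. i \<in> I \<Longrightarrow> x \<in> free_space X \<Longrightarrow> f i x \<in> free_space Y"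
  shows "is_transpose X Y (\<lambda>x. \<Sum>i\<in>I. f i x) (\<lambda>x. \<Sum>i\<in>I. g i x)"
  unfolding is_transpose_def
proof (intro conjI ballI)
  fix \<alpha> assume \<alpha>: "\<alpha> \<in> free_space Y"
  then show "(\<Sum>i\<in>I. g i \<alpha>) \<in> free_space X"
    using assms(3) by (intro free_space_sum) (auto simp: is_transpose_def)
  fix x assume x: "x \<in> free_space X"
  have "pairing (\<Sum>i\<in>I. g i \<alpha>) x = (\<Sum>i\<in>I. pairing (g i \<alpha>) x)"
    unfolding pairing_eq[OF assms(1) x] sum_fun_apply sum_distrib_right by (rule sum.swap)
  also have "\<dots> = (\<Sum>i\<in>I. pairing \<alpha> (f i x))"
    using assms(3) \<alpha> x by (intro sum.cong) (auto simp: is_transpose_def)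
  also have "\<dots> = (\<Sum>i\<in>I. \<Sum>c\<in>Y. \<alpha> c * f i x c)"
    using assms(4) x by (intro sum.cong pairing_eq[OF assms(2)]) auto
  also have "\<dots> = pairing \<alpha> (\<Sum>i\<in>I. f i x)"
    using assms(4) x
    by (subst pairing_eq[OF assms(2)], intro free_space_sum)
      (auto simp: sum_fun_apply sum_distrib_left intro: sum.swap)
  finally show "pairing (\<Sum>i\<in>I. g i \<alpha>) x = pairing \<alpha> (\<Sum>i\<in>I. f i x)" .
qed

lemma is_transpose_scale:
  assumes "finite X" "finite Y" and "is_transpose X Y f g"
    and "\<And>x. x \<in> free_space X \<Longrightarrow> f x \<in> free_space Y"
  shows "is_transpose X Y (\<lambda>x. t *\<^sub>v f x) (\<lambda>x. t *\<^sub>v g x)"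
  unfolding is_transpose_def
proof (intro conjI ballI)
  fix \<alpha> assume \<alpha>: "\<alpha> \<in> free_space Y"
  then show "t *\<^sub>v g \<alpha> \<in> free_space X"
    using assms(3) by (intro free_space_scale) (auto simp: is_transpose_def)
  fix x assume x: "x \<in> free_space X"
  have "pairing (t *\<^sub>v g \<alpha>) x = t * pairing (g \<alpha>) x"
    by (simp add: pairing_eq[OF assms(1) x] scale_def sum_distrib_left mult.assoc)
  also have "\<dots> = t * pairing \<alpha> (f x)"
    using assms(3) \<alpha> x by (simp add: is_transpose_def)
  also have "\<dots> = pairing \<alpha> (t *\<^sub>v f x)"
    unfolding pairing_eq[OF assms(2) assms(4)[OF x]]
      pairing_eq[OF assms(2) free_space_scale[OF assms(4)[OF x]]]
    by (simp add: scale_def sum_distrib_left mult.left_commute)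
  finally show "pairing (t *\<^sub>v g \<alpha>) x = pairing \<alpha> (t *\<^sub>v f x)" .
qed

lemma vec_eqI_pairing:
  assumes "finite X" "\<alpha> \<in> free_space X" "\<beta> \<in> free_space X"
    and "\<And>x. x \<in> free_space X \<Longrightarrow> pairing \<alpha> x = pairing \<beta> x"
  shows "\<alpha> = \<beta>"
proof
  fix c
  show "\<alpha> c = \<beta> c"
  proof (cases "c \<in> X")
    case True
    then have d: "delta c \<in> free_space X" by (auto simp: free_space_def delta_def)
    have "pairing \<gamma> (delta c) = \<gamma> c" for \<gamma>
    proof -
      have "{b. delta c b \<noteq> 0} = {c}" by (auto simp: delta_def)
      then show ?thesis by (simp add: pairing_def delta_def)
    qed
    then show ?thesis using assms(4)[OF d] by simp
  next
    case False
    then have "\<alpha> c = 0" "\<beta> c = 0" using assms(2,3) by (auto simp: free_space_def)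
    then show ?thesis by simp
  qed
qed

text \<open>The pairing is nondegenerate, as testing against each \<open>delta c\<close> shows. This
  is the device that carries each identity between chain maps over to cochains.\<close>

lemma is_transpose_unique:
  assumes "finite X" "is_transpose X Y f g" "is_transpose X Y f' g'"
    and "\<And>x. x \<in> free_space X \<Longrightarrow> f x = f' x" and "\<alpha> \<in> free_space Y"
  shows "g \<alpha> = g' \<alpha>"
  by (rule vec_eqI_pairing[OF assms(1)])
    (use assms in \<open>auto simp: is_transpose_def\<close>)

lemma is_transpose_comp:
  assumes "is_transpose X Y f g" "is_transpose Y Z f' g'"
    and "\<And>x. x \<in> free_space X \<Longrightarrow> f x \<in> free_space Y"
  shows "is_transpose X Z (\<lambda>x. f' (f x)) (\<lambda>\<alpha>. g (g' \<alpha>))"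
  using assms by (simp add: is_transpose_def)

lemma is_transpose_add:
  assumes "finite X" "finite Y" "is_transpose X Y f g" "is_transpose X Y f' g'"
    and "\<And>x. x \<in> free_space X \<Longrightarrow> f x \<in> free_space Y" "\<And>x. x \<in> free_space X \<Longrightarrow> f' x \<in> free_space Y"
  shows "is_transpose X Y (\<lambda>x. f x + f' x) (\<lambda>x. g x + g' x)"
  using is_transpose_sum[of X Y "UNIV :: bool set" "\<lambda>b. if b then f else f'" "\<lambda>b. if b then g else g'"]
  using assms by (simp add: UNIV_bool add.commute)

lemma is_transpose_id: "is_transpose X X (\<lambda>x. x) (\<lambda>x. x)"
  by (simp add: is_transpose_def)

lemma is_transpose_0: "is_transpose X Y (\<lambda>x. 0) (\<lambda>x. 0)"
  by (simp add: is_transpose_def pairing_def free_space_0)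

text \<open>\<open>is_transpose\<close> does not mention linearity or degree of \<open>g\<close>.
  Both follow by pairing with \<open>delta c\<close>: it writes \<open>g \<alpha> c\<close> as a sum
  linear in \<alpha>, whose nonzero terms link degree \<open>dg c\<close> with
  \<open>dg c + r\<close>.\<close>

lemma graded_map_transpose:
  assumes "finite X" "finite Y" and t: "is_transpose X Y f g" and f: "graded_map dg X Y r f"
  shows "graded_map dg Y X (- r) g"
proof -
  have val: "g \<alpha> c = (\<Sum>b\<in>Y. \<alpha> b * f (delta c) b)" if \<alpha>: "\<alpha> \<in> free_space Y" and "c \<in> X" for \<alpha> c
  proof -
    have d: "delta c \<in> free_space X" using \<open>c \<in> X\<close> by (auto simp: free_space_def delta_def)
    have "{b. delta c b \<noteq> 0} = {c}" by (auto simp: delta_def)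
    then have "g \<alpha> c = pairing (g \<alpha>) (delta c)" by (simp add: pairing_def delta_def)
    also have "\<dots> = pairing \<alpha> (f (delta c))" by (rule is_transpose_pairing[OF t \<alpha> d])
    also have "\<dots> = (\<Sum>b\<in>Y. \<alpha> b * f (delta c) b)"
      by (rule pairing_eq[OF assms(2) graded_map_in_space[OF f d]])
    finally show ?thesis .
  qed
  have out: "g \<alpha> c = 0" if "\<alpha> \<in> free_space Y" "c \<notin> X" for \<alpha> c
    using is_transpose_in_space[OF t that(1)] that(2) by (auto simp: free_space_def)
  show ?thesis
    unfolding graded_map_def linear_between_def
  proof (intro conjI ballI allI)
    fix \<alpha> \<beta> and s :: real
    assume \<alpha>: "\<alpha> \<in> free_space Y"
    show "g \<alpha> \<in> free_space X" by (rule is_transpose_in_space[OF t \<alpha>])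
    show "g (s *\<^sub>v \<alpha>) = s *\<^sub>v g \<alpha>"
    proof
      fix c
      show "g (s *\<^sub>v \<alpha>) c = (s *\<^sub>v g \<alpha>) c"
        using val[OF \<alpha>] val[OF free_space_scale[OF \<alpha>, of s]] out[OF \<alpha>] out[OF free_space_scale[OF \<alpha>, of s]]
        by (cases "c \<in> X") (simp_all add: scale_def sum_distrib_left mult.assoc)
    qed
    assume \<beta>: "\<beta> \<in> free_space Y"
    show "g (\<alpha> + \<beta>) = g \<alpha> + g \<beta>"
    proof
      fix c
      show "g (\<alpha> + \<beta>) c = (g \<alpha> + g \<beta>) c"
        using val[OF \<alpha>] val[OF \<beta>] val[OF free_space_add[OF \<alpha> \<beta>]] out[OF \<alpha>] out[OF \<beta>]
          out[OF free_space_add[OF \<alpha> \<beta>]]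
        by (cases "c \<in> X") (simp_all add: distrib_right sum.distrib)
    qed
  next
    fix q \<alpha> assume \<alpha>q: "\<alpha> \<in> graded_piece dg Y q"
    then have \<alpha>: "\<alpha> \<in> free_space Y" using graded_piece_subset by blast
    show "g \<alpha> \<in> graded_piece dg X (q + - r)"
      unfolding graded_piece_def free_space_def
    proof (clarify)
      fix c assume nz: "g \<alpha> c \<noteq> 0"
      then have c: "c \<in> X" using out[OF \<alpha>] by blast
      obtain b where "\<alpha> b * f (delta c) b \<noteq> 0"
        using nz unfolding val[OF \<alpha> c] by (rule sum.not_neutral_contains_not_neutral)
      moreover have "delta c \<in> graded_piece dg X (dg c)"
        using c by (auto simp: graded_piece_def free_space_def delta_def)
      then have "f (delta c) \<in> graded_piece dg Y (dg c + r)"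
        using f by (simp add: graded_map_def)
      ultimately have "dg b = q" "dg b = dg c + r"
        using \<alpha>q by (auto simp: graded_piece_def free_space_def)
      then show "c \<in> X \<and> dg c = q + - r" using c by simp
    qed
  qed
qed

text \<open>Transposition reverses composition, so inclusion and projection trade places: the side
  condition for \<open>a'\<close> and \<open>i'\<close> comes from that for \<open>p\<close> and
  \<open>a\<close>, and the one for \<open>p'\<close> and \<open>a'\<close> from that for
  \<open>a\<close> and \<open>i\<close>.\<close>

lemma special_deformation_retraction_transpose:
  assumes fin: "finite X" "finite Y"
    and sdr: "special_deformation_retraction dg s X dX Y dY i p a"
    and tr: "is_transpose X X dX dX'" "is_transpose Y Y dY dY'" "is_transpose X Y p i'"
      "is_transpose Y X i p'" "is_transpose X X a a'"
  shows "special_deformation_retraction dg (- s) X dX' Y dY' i' p' a'"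
proof -
  have gr: "graded_map dg X X s dX" "graded_map dg Y Y s dY" "graded_map dg Y X 0 i"
    "graded_map dg X Y 0 p" "graded_map dg X X (- s) a"
    using sdr by (auto simp: special_deformation_retraction_def is_complex_def is_complex_map_def)
  have eq: "x \<in> free_space X \<Longrightarrow> dX (dX x) = 0" "y \<in> free_space Y \<Longrightarrow> dY (dY y) = 0"
    "y \<in> free_space Y \<Longrightarrow> dX (i y) = i (dY y)" "x \<in> free_space X \<Longrightarrow> dY (p x) = p (dX x)"
    "y \<in> free_space Y \<Longrightarrow> p (i y) = y"
    "x \<in> free_space X \<Longrightarrow> dX (a x) + a (dX x) + i (p x) = x"
    "x \<in> free_space X \<Longrightarrow> a (a x) = 0" "y \<in> free_space Y \<Longrightarrow> a (i y) = 0"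
    "x \<in> free_space X \<Longrightarrow> p (a x) = 0" for x y
    using sdr
    by (simp_all add: special_deformation_retraction_def is_complex_def is_complex_map_def)
  note sp = gr[THEN graded_map_in_space]
  have gr': "graded_map dg X X (- s) dX'" "graded_map dg Y Y (- s) dY'" "graded_map dg Y X 0 i'"
    "graded_map dg X Y 0 p'" "graded_map dg X X (- (- s)) a'"
    using graded_map_transpose[OF fin(1,1) tr(1) gr(1)] graded_map_transpose[OF fin(2,2) tr(2) gr(2)]
      graded_map_transpose[OF fin tr(3) gr(4)] graded_map_transpose[OF fin(2,1) tr(4) gr(3)]
      graded_map_transpose[OF fin(1,1) tr(5) gr(5)]
    by simp_all
  note uniq = is_transpose_unique[OF fin(1)] is_transpose_unique[OF fin(2)]
  have "dX' (dX' x) = 0" if "x \<in> free_space X" for x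
    using uniq(1)[OF is_transpose_comp[OF tr(1) tr(1) sp(1)] is_transpose_0 eq(1) that] by simp
  moreover have "dY' (dY' y) = 0" if "y \<in> free_space Y" for y
    using uniq(2)[OF is_transpose_comp[OF tr(2) tr(2) sp(2)] is_transpose_0 eq(2) that] by simp
  moreover have "dX' (i' y) = i' (dY' y)" if "y \<in> free_space Y" for y
    using uniq(1)[OF is_transpose_comp[OF tr(1) tr(3) sp(1)] is_transpose_comp[OF tr(3) tr(2) sp(4)]
        eq(4)[symmetric] that] by simp
  moreover have "dY' (p' x) = p' (dX' x)" if "x \<in> free_space X" for x
    using uniq(2)[OF is_transpose_comp[OF tr(2) tr(4) sp(2)] is_transpose_comp[OF tr(4) tr(1) sp(3)]
        eq(3)[symmetric] that] by simp
  moreover have "p' (i' y) = y" if "y \<in> free_space Y" for y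
    using uniq(2)[OF is_transpose_comp[OF tr(4) tr(3) sp(3)] is_transpose_id eq(5) that] by simp
  moreover have "a' (a' x) = 0" if "x \<in> free_space X" for x
    using uniq(1)[OF is_transpose_comp[OF tr(5) tr(5) sp(5)] is_transpose_0 eq(7) that] by simp
  moreover have "a' (i' y) = 0" if "y \<in> free_space Y" for y
    using uniq(1)[OF is_transpose_comp[OF tr(5) tr(3) sp(5)] is_transpose_0 eq(9) that] by simp
  moreover have "p' (a' x) = 0" if "x \<in> free_space X" for x
    using uniq(2)[OF is_transpose_comp[OF tr(4) tr(5) sp(3)] is_transpose_0 eq(8) that] by simp
  moreover have "dX' (a' x) + a' (dX' x) = x - i' (p' x)" if "x \<in> free_space X" for x
  proof -
    \<comment> \<open>The homotopy identity is used in subtraction-free form because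
      \<open>is_transpose_add\<close> treats sums; the two anticommutator terms change places under
      transposition.\<close>
    have "is_transpose X X (\<lambda>x. a (dX x) + dX (a x) + i (p x)) (\<lambda>x. dX' (a' x) + a' (dX' x) + i' (p' x))"
      by (intro is_transpose_add[OF fin(1,1)] is_transpose_comp[OF tr(1,5)]
          is_transpose_comp[OF tr(5,1)] is_transpose_comp[OF tr(3,4)] sp free_space_add)
    moreover have "a (dX z) + dX (a z) + i (p z) = z" if "z \<in> free_space X" for z
      using eq(6)[OF that] by (metis add.commute)
    ultimately have "dX' (a' x) + a' (dX' x) + i' (p' x) = x"
      by (rule uniq(1)[OF _ is_transpose_id _ that])
    then show ?thesis by (simp add: eq_diff_eq)
  qed
  ultimately show ?thesis
    using gr' by (simp add: special_deformation_retraction_def is_complex_def is_complex_map_def)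
qed

section \<open>Transposes of tensor products\<close>

lemma tensor_matrix_transpose:
  assumes F: "\<And>j. j < n \<Longrightarrow> homogeneous (K j) (L j) (r j) (F j)"
    and G: "\<And>j c c'. j < n \<Longrightarrow> G j c c' = F j c' c"
  shows "is_transpose (box n K) (box n L) (tensor_matrix n F) (tensor_matrix n G)"
  unfolding is_transpose_def
proof (intro conjI ballI)
  have G': "homogeneous (L j) (K j) (- r j) (G j)" if "j < n" for j
    using F[OF that] G[OF that] by (simp add: homogeneous_def)
  fix \<alpha> assume \<alpha>: "\<alpha> \<in> free_space (box n L)"
  then show "tensor_matrix n G \<alpha> \<in> free_space (box n K)"
    using tensor_matrix_graded[of n L K "\<lambda>j. - r j" G, OF G' refl] by (rule graded_map_in_space[rotated])
  fix x assume x: "x \<in> free_space (box n K)"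
  have Fx: "tensor_matrix n F x \<in> free_space (box n L)"
    using tensor_matrix_graded[of n K L r F, OF F refl] x by (rule graded_map_in_space)
  let ?L = "{cs :: cell list. length cs = n}"
  have pair: "pairing \<beta> y = (\<Sum>c\<in>?L. \<beta> c * y c)" if "y \<in> free_space (box n M)" for \<beta> y M
    using that by (intro pairing_eq) (auto simp: free_space_def box_def)
  have "pairing (tensor_matrix n G \<alpha>) x
      = (\<Sum>c\<in>?L. \<Sum>b\<in>?L. (\<Prod>j<n. F j (b ! j) (c ! j)) * \<alpha> b * x c)"
    by (simp add: pair[OF x] tensor_matrix_def G sum_distrib_right)
  also have "\<dots> = (\<Sum>b\<in>?L. \<Sum>c\<in>?L. \<alpha> b * ((\<Prod>j<n. F j (b ! j) (c ! j)) * x c))"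
    by (subst sum.swap) (simp add: mult_ac)
  also have "\<dots> = pairing \<alpha> (tensor_matrix n F x)"
    unfolding pair[OF Fx] by (simp add: tensor_matrix_def sum_distrib_left)
  finally show "pairing (tensor_matrix n G \<alpha>) x = pairing \<alpha> (tensor_matrix n F x)" .
qed

text \<open>Transposing moves the parity from the column to the row. It is present only in slots
  before \<open>m\<close>, where the factor is even and a nonzero entry has equal parities on both
  sides.\<close>

lemma koszul_map_transpose:
  assumes F: "\<And>j. j < n \<Longrightarrow> homogeneous (K j) (L j) (if j = m then r else 0) (F j)"
    and G: "\<And>j c c'. j < n \<Longrightarrow> G j c c' = F j c' c"
  shows "is_transpose (box n K) (box n L) (koszul_map n m F) (koszul_map n m G)"
  unfolding koszul_map_def
proof (rule tensor_matrix_transpose, rule homogeneous_twist, rule F)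
  fix j c c' assume j: "j < n"
  show "twist m G j c c' = twist m F j c' c"
    using homogeneous_parity[OF F[OF j], of c' c] by (cases "F j c' c = 0") (auto simp: twist_def G[OF j])
qed

section \<open>The cubical complexes\<close>

definition total_differential ::
  "nat \<Rightarrow> (nat \<Rightarrow> cell set) \<Rightarrow> (nat \<Rightarrow> cell_matrix) \<Rightarrow> cell list vec \<Rightarrow> cell list vec" where
  "total_differential n K D x = (\<Sum>l<n. koszul_map n l (differential_factor K D l) x)"

lemma homogeneous_differential_factor:
  assumes "homogeneous (K j) (K j) r (D j)"
  shows "homogeneous (K j) (K j) (if j = l then r else 0) (differential_factor K D l j)"
  using assms homogeneous_maps(1) by (cases "j = l") (simp_all add: differential_factor_def)

lemma total_differential_graded:
  assumes "\<And>j. j < n \<Longrightarrow> homogeneous (K j) (K j) r (D j)"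
  shows "graded_map cell_deg (box n K) (box n K) r (total_differential n K D)"
  unfolding total_differential_def
  by (intro graded_map_sum koszul_map_graded homogeneous_differential_factor assms) auto

text \<open>Exchanging the two summations turns the sum into its own negative. The case
  \<open>i = j\<close> of the hypothesis covers the diagonal terms.\<close>

lemma sum_antisymmetric:
  fixes t :: "'i \<Rightarrow> 'i \<Rightarrow> 'b vec"
  assumes "\<And>i j. i \<in> I \<Longrightarrow> j \<in> I \<Longrightarrow> t i j + t j i = 0"
  shows "(\<Sum>i\<in>I. \<Sum>j\<in>I. t i j) = 0"
proof
  fix c
  have "(\<Sum>i\<in>I. \<Sum>j\<in>I. t i j c) = (\<Sum>i\<in>I. \<Sum>j\<in>I. - t j i c)"
  proof (intro sum.cong refl)
    fix i j assume "i \<in> I" "j \<in> I"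
    then have "(t i j + t j i) c = 0" by (simp add: assms)
    then show "t i j c = - t j i c" by simp
  qed
  also have "\<dots> = - (\<Sum>i\<in>I. \<Sum>j\<in>I. t i j c)"
    by (subst sum.swap) (simp add: sum_negf)
  finally show "(\<Sum>i\<in>I. \<Sum>j\<in>I. t i j) c = 0 c"
    by (simp add: sum_fun_apply)
qed

lemma total_differential_square:
  assumes "odd r" and hom: "\<And>j. j < n \<Longrightarrow> homogeneous (K j) (K j) r (D j)"
    and D2: "\<And>j. j < n \<Longrightarrow> D j \<odot> D j = 0"
  shows "total_differential n K D (total_differential n K D x) = 0"
proof -
  let ?W = "\<lambda>l. koszul_map n l (differential_factor K D l)"
  have "?W l (?W m x) + ?W m (?W l x) = 0" if "l < n" "m < n" for l m
  proof (cases "l = m")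
    case True
    have "?W m (?W m x) = 0"
      by (subst koszul_map_same_position[where K = K and L = K and s = r],
          rule homogeneous_differential_factor[OF hom], assumption,
          rule tensor_matrix_factor_zero[OF that(2)]) (simp add: differential_factor_def D2 that(2))
    then show ?thesis using True by simp
  next
    case False
    then show ?thesis
      using that assms(1) hom
      by (intro koszul_map_anticommute[where K = K and r = r and s = r])
        (auto intro: homogeneous_maps(1) homogeneous_differential_factor simp: differential_factor_def idm_mult[OF hom])
  qed
  then have "(\<Sum>l<n. \<Sum>m<n. ?W l (?W m x)) = 0"
    by (intro sum_antisymmetric) auto
  then show ?thesis
    by (simp only: total_differential_def koszul_map_linear)
qed

lemma total_differential_chain_map:
  assumes E: "\<And>j. j < n \<Longrightarrow> homogeneous (K j) (L j) 0 (E j)"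
    and ED: "\<And>j. j < n \<Longrightarrow> D' j \<odot> E j = E j \<odot> D j"
  shows "total_differential n L D' (tensor_matrix n E x) = tensor_matrix n E (total_differential n K D x)"
proof -
  have "koszul_map n l (differential_factor L D' l) (tensor_matrix n E x)
      = tensor_matrix n E (koszul_map n l (differential_factor K D l) x)" for l
    unfolding tensor_matrix_koszul_map
    by (subst koszul_map_tensor_matrix[where K = K and L = L], rule E, assumption, rule koszul_map_cong)
      (simp add: differential_factor_def ED idm_mult[OF E])
  then show ?thesis
    by (simp only: total_differential_def tensor_matrix_sum)
qed

section \<open>The symmetrized homotopy\<close>

abbreviation "cube_incl k j \<equiv> (if j < k then incl else idm interval)"
abbreviation "cube_proj k j \<equiv> (if j < k then proj else idm interval)"
abbreviation "sym_factor A P k \<sigma> j l \<equiv> homotopy_factor A P k j (inv \<sigma> l)"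

lemma homogeneous_incl_proj: "homogeneous star_interval star_interval 0 incl_proj"
  unfolding incl_proj_eq
  using homogeneous_mult[OF homogeneous_maps(4,5)] by simp

lemma homogeneous_bdm: "homogeneous (star_factor k j) (star_factor k j) (- 1) (bdm (star_factor k j))"
  using homogeneous_maps(2,3) by (simp add: star_factor_def)

lemma homogeneous_cube_incl: "homogeneous interval (star_factor k j) 0 (cube_incl k j)"
  using homogeneous_maps(1,4) by (simp add: star_factor_def)

lemma homogeneous_cube_proj: "homogeneous (star_factor k j) interval 0 (cube_proj k j)"
  using homogeneous_maps(1,5) by (simp add: star_factor_def)

lemma homogeneous_sym_factor:
  assumes "homogeneous star_interval star_interval r A"
    and "homogeneous star_interval star_interval 0 P" and "j < k" and \<sigma>: "\<sigma> permutes {..<k}"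
  shows "homogeneous (star_factor k l) (star_factor k l) (if l = \<sigma> j then r else 0)
    (sym_factor A P k \<sigma> j l)"
proof -
  have "inv \<sigma> l = j \<longleftrightarrow> l = \<sigma> j"
    using permutes_inverses[OF \<sigma>] by auto
  then show ?thesis
    using homogeneous_homotopy_factor[OF assms(1-3), of "inv \<sigma> l"]
    by (simp add: star_factor_permutes[OF permutes_inv[OF \<sigma>]])
qed

lemma permutes_less:
  "\<sigma> permutes {..<k} \<Longrightarrow> \<sigma> j < k \<longleftrightarrow> j < (k :: nat)"
  using permutes_in_image[of \<sigma> "{..<k}" j] by simp

lemma permutes_less_inv:
  "\<sigma> permutes {..<k} \<Longrightarrow> inv \<sigma> j < k \<longleftrightarrow> j < (k :: nat)"
  by (rule permutes_less[OF permutes_inv])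

lemma sym_factor_at:
  "\<sigma> permutes {..<k} \<Longrightarrow> sym_factor A P k \<sigma> j (\<sigma> j) = A"
  by (simp add: homotopy_factor_def permutes_inverses)

lemma symmetrized_homotopy_graded:
  assumes "homogeneous star_interval star_interval r A"
    and "homogeneous star_interval star_interval 0 P" and "k \<le> n"
  shows "graded_map cell_deg (box n (star_factor k)) (box n (star_factor k)) r (symmetrized_homotopy A P k n)"
  unfolding symmetrized_homotopy_def
proof (intro graded_map_scale graded_map_sum)
  fix \<sigma> j assume "\<sigma> \<in> {\<sigma>. \<sigma> permutes {..<k}}" "j \<in> {..<k}"
  then show "graded_map cell_deg (box n (star_factor k)) (box n (star_factor k)) r
      (koszul_map n (\<sigma> j) (sym_factor A P k \<sigma> j))"
    using assms permutes_less[of \<sigma> k j]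
    by (intro koszul_map_graded homogeneous_sym_factor) auto
qed

text \<open>Transposition acts inside each slot and leaves the slots in place, so the summand for
  \<sigma> and \<open>j\<close> goes to the summand for the same \<sigma> and
  \<open>j\<close>.\<close>

lemma symmetrized_homotopy_transpose:
  assumes A: "homogeneous star_interval star_interval r A"
    and P: "homogeneous star_interval star_interval 0 P" and "k \<le> n"
    and A': "\<And>c c'. A' c c' = A c' c" and P': "\<And>c c'. P' c c' = P c' c"
  shows "is_transpose (box n (star_factor k)) (box n (star_factor k))
    (symmetrized_homotopy A P k n) (symmetrized_homotopy A' P' k n)"
proof -
  let ?X = "box n (star_factor k)"
  have gr: "graded_map cell_deg ?X ?X r (koszul_map n (\<sigma> j) (sym_factor A P k \<sigma> j))"
    and tr: "is_transpose ?X ?X (koszul_map n (\<sigma> j) (sym_factor A P k \<sigma> j))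
      (koszul_map n (\<sigma> j) (sym_factor A' P' k \<sigma> j))"
    if "\<sigma> permutes {..<k}" "j < k" for \<sigma> j
  proof -
    show "graded_map cell_deg ?X ?X r (koszul_map n (\<sigma> j) (sym_factor A P k \<sigma> j))"
      using assms that permutes_less[of \<sigma> k j]
      by (intro koszul_map_graded homogeneous_sym_factor) auto
    show "is_transpose ?X ?X (koszul_map n (\<sigma> j) (sym_factor A P k \<sigma> j))
      (koszul_map n (\<sigma> j) (sym_factor A' P' k \<sigma> j))"
      by (rule koszul_map_transpose[where r = r], rule homogeneous_sym_factor[OF A P that(2,1)])
        (auto simp: homotopy_factor_def A' P' matrix_on_def delta_def)
  qed
  show ?thesis
    unfolding symmetrized_homotopy_def
    by (intro is_transpose_scale is_transpose_sum free_space_sum finite_box)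
      (auto intro: tr graded_map_in_space[OF gr])
qed

lemma total_differential_transpose:
  assumes D: "\<And>j. j < n \<Longrightarrow> homogeneous (K j) (K j) r (D j)"
    and D': "\<And>j c c'. j < n \<Longrightarrow> D' j c c' = D j c' c"
  shows "is_transpose (box n K) (box n K) (total_differential n K D) (total_differential n K D')"
  unfolding total_differential_def
proof (rule is_transpose_sum)
  fix l assume "l \<in> {..<n}"
  then have l: "l < n" by simp
  note hom = homogeneous_differential_factor[OF D]
  show "is_transpose (box n K) (box n K) (koszul_map n l (differential_factor K D l))
      (koszul_map n l (differential_factor K D' l))"
    by (rule koszul_map_transpose[where r = r], rule hom)
      (auto simp: differential_factor_def D' matrix_on_def delta_def)
  show "koszul_map n l (differential_factor K D l) x \<in> free_space (box n K)"
    if x: "x \<in> free_space (box n K)" for x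
    by (rule graded_map_in_space[OF _ x], rule koszul_map_graded[OF _ l], rule hom)
qed simp_all

text \<open>Each summand has its odd factor \<open>A\<close> in the star slot
  \<open>\<sigma> j\<close>; composing there gives zero, and one zero slot annihilates a tensor
  product. The lemma for composition on the other side works alike.\<close>

lemma symmetrized_homotopy_tensor_matrix:
  assumes E: "\<And>j. j < n \<Longrightarrow> homogeneous (K j) (L j) 0 (E j)"
    and "k \<le> n" and "\<And>l. l < k \<Longrightarrow> A \<odot> E l = 0"
  shows "symmetrized_homotopy A P k n (tensor_matrix n E x) = 0"
proof -
  have "koszul_map n (\<sigma> j) (sym_factor A P k \<sigma> j) (tensor_matrix n E x) = 0"
    if "\<sigma> permutes {..<k}" "j < k" for \<sigma> j
  proof -
    have "\<sigma> j < k" using that by (simp add: permutes_less)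
    show ?thesis
      by (subst koszul_map_tensor_matrix[where K = K and L = L], rule E, assumption,
          intro koszul_map_zero[of "\<sigma> j"]) (use \<open>\<sigma> j < k\<close> assms(2,3) that in \<open>simp_all add: sym_factor_at\<close>)
  qed
  then show ?thesis
    by (simp add: symmetrized_homotopy_def scale_0)
qed

lemma tensor_matrix_symmetrized_homotopy:
  assumes "k \<le> n" and "\<And>l. l < k \<Longrightarrow> E l \<odot> A = 0"
  shows "tensor_matrix n E (symmetrized_homotopy A P k n x) = 0"
proof -
  have "tensor_matrix n E (koszul_map n (\<sigma> j) (sym_factor A P k \<sigma> j) x) = 0"
    if "\<sigma> permutes {..<k}" "j < k" for \<sigma> j
  proof -
    have "\<sigma> j < k" using that by (simp add: permutes_less)
    then show ?thesis
      unfolding tensor_matrix_koszul_map using assms that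
      by (intro koszul_map_zero[of "\<sigma> j"]) (simp_all add: sym_factor_at)
  qed
  then show ?thesis
    by (simp add: symmetrized_homotopy_def tensor_matrix_scale tensor_matrix_sum scale_0)
qed

text \<open>
  Any two summands of the symmetrized homotopy anticommute, even for different permutations:
  where their factors do not commute for trivial reasons, both products vanish.
\<close>

lemma symmetrized_homotopy_square:
  assumes A: "homogeneous star_interval star_interval r A"
    and P: "homogeneous star_interval star_interval 0 P" and "k \<le> n" "odd r"
    and zero: "A \<odot> A = 0" "A \<odot> P = 0" "P \<odot> A = 0"
  shows "symmetrized_homotopy A P k n (symmetrized_homotopy A P k n x) = 0"
proof -
  define I where "I = {\<sigma>. \<sigma> permutes {..<k}} \<times> {..<k}"
  define W where "W = (\<lambda>(\<sigma>, j). koszul_map n (\<sigma> j) (sym_factor A P k \<sigma> j))"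
  have lin: "W p (\<Sum>q\<in>J. f q) = (\<Sum>q\<in>J. W p (f q))" "W p (s *\<^sub>v y) = s *\<^sub>v W p y" for p J f s y
    by (cases p; simp only: W_def prod.case koszul_map_linear)+
  have S: "symmetrized_homotopy A P k n y = (1 / fact k) *\<^sub>v (\<Sum>p\<in>I. W p y)" for y
    unfolding symmetrized_homotopy_def I_def W_def sum.cartesian_product
    by (simp only: case_prod_unfold)
  have "W p (W q x) + W q (W p x) = 0" if "p \<in> I" "q \<in> I" for p q
  proof -
    obtain \<sigma> i \<tau> j where pq: "p = (\<sigma>, i)" "q = (\<tau>, j)"
      and \<sigma>: "\<sigma> permutes {..<k}" "i < k" and \<tau>: "\<tau> permutes {..<k}" "j < k"
      using \<open>p \<in> I\<close> \<open>q \<in> I\<close> unfolding I_def by blast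
    note hom = homogeneous_sym_factor[OF A P]
    have less: "\<sigma> i < k" "\<tau> j < k" using \<sigma> \<tau> by (simp_all add: permutes_less)
    show ?thesis
    proof (cases "\<sigma> i = \<tau> j")
      case True
      \<comment> \<open>With both odd factors in one slot, \<open>A \<odot> A = 0\<close>
        annihilates the product in either order.\<close>
      have z: "koszul_map n (\<rho> a) (sym_factor A P k \<rho> a) (koszul_map n (\<rho> a) (sym_factor A P k \<upsilon> b) x) = 0"
        if "\<rho> permutes {..<k}" "a < k" "\<upsilon> permutes {..<k}" "b < k" "\<rho> a = \<upsilon> b" for \<rho> \<upsilon> a b
        unfolding \<open>\<rho> a = \<upsilon> b\<close>
      proof (subst koszul_map_same_position[where K = "star_factor k" and L = "star_factor k" and s = r])
        show "homogeneous (star_factor k l) (star_factor k l) (if l = \<upsilon> b then r else 0)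
          (sym_factor A P k \<upsilon> b l)" for l
          by (rule hom[OF that(4,3)])
        have "\<upsilon> b < n" using that \<open>k \<le> n\<close> permutes_less[of \<upsilon> k b] by auto
        then show "tensor_matrix n (\<lambda>l. sym_factor A P k \<rho> a l \<odot> sym_factor A P k \<upsilon> b l) x = 0"
        proof (rule tensor_matrix_factor_zero)
          show "sym_factor A P k \<rho> a (\<upsilon> b) \<odot> sym_factor A P k \<upsilon> b (\<upsilon> b) = 0"
            using sym_factor_at[OF that(1), of A P a] sym_factor_at[OF that(3), of A P b] that(5) zero(1)
            by simp
        qed
      qed
      show ?thesis
        using z[OF \<sigma> \<tau> True] z[OF \<tau> \<sigma> True[symmetric]] True by (simp add: pq W_def)
    next
      case False
      \<comment> \<open>In a star slot both factors are among \<open>A\<close>, \<open>P\<close> and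
        the identity, which commute pairwise because both mixed products of \<open>A\<close> and
        \<open>P\<close> vanish.\<close>
      have "sym_factor A P k \<sigma> i l \<odot> sym_factor A P k \<tau> j l
          = sym_factor A P k \<tau> j l \<odot> sym_factor A P k \<sigma> i l" for l
      proof (cases "l < k")
        case True
        then have "inv \<sigma> l < k" "inv \<tau> l < k"
          using \<sigma> \<tau> by (simp_all add: permutes_less_inv)
        then show ?thesis
          using zero idm_mult[OF A] idm_mult[OF P]
          by (simp add: homotopy_factor_def star_factor_def)
      next
        case False
        then have "inv \<sigma> l = l" "inv \<tau> l = l"
          using permutes_not_in[OF permutes_inv[OF \<sigma>(1)]] permutes_not_in[OF permutes_inv[OF \<tau>(1)]]
          by simp_all
        then show ?thesis
          using False \<sigma> \<tau> by (simp add: homotopy_factor_def)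
      qed
      then show ?thesis
        using less \<open>k \<le> n\<close> \<open>odd r\<close> False unfolding pq W_def prod.case
        by (intro koszul_map_anticommute[where K = "star_factor k" and r = r and s = r]
            hom \<sigma> \<tau>) auto
    qed
  qed
  then have "(\<Sum>p\<in>I. \<Sum>q\<in>I. W p (W q x)) = 0"
    by (rule sum_antisymmetric)
  then show ?thesis
    by (simp only: S lin scale_sum[symmetric] scale_0)
qed

text \<open>
  In the order given by \<open>\<sigma>\<close> the anticommutators of the differential with the summands
  telescope: the \<open>j\<close>-th one replaces \<open>P\<close> by the identity at position \<open>\<sigma> j\<close>.
\<close>

lemma symmetrized_homotopy_identity:
  fixes k n :: nat and D A P
  defines "Ds \<equiv> \<lambda>j. D (star_factor k j)"
  assumes D: "\<And>j. homogeneous (star_factor k j) (star_factor k j) s (Ds j)"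
    and A: "homogeneous star_interval star_interval r A"
    and P: "homogeneous star_interval star_interval 0 P"
    and "k \<le> n" "odd r" "odd s"
    and DP: "D star_interval \<odot> P = P \<odot> D star_interval"
    and DA: "D star_interval \<odot> A + A \<odot> D star_interval + P = idm star_interval"
    and x: "x \<in> free_space (box n (star_factor k))"
  shows "total_differential n (star_factor k) Ds (symmetrized_homotopy A P k n x)
      + symmetrized_homotopy A P k n (total_differential n (star_factor k) Ds x)
    = x - tensor_matrix n (\<lambda>j. if j < k then P else idm interval) x"
proof -
  let ?K = "star_factor k"
  let ?d = "\<lambda>l. differential_factor ?K Ds l"
  define W where "W = (\<lambda>\<sigma> j. koszul_map n (\<sigma> j) (sym_factor A P k \<sigma> j))"
  \<comment> \<open>\<open>T \<sigma> j\<close> keeps \<open>P\<close> in the star slots numbered at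
    least \<open>j\<close> in the order of \<sigma>. It interpolates from \<open>P\<close> in all
    star slots at \<open>j = 0\<close> to the identity at \<open>j = k\<close>.\<close>
  define E where "E = (\<lambda>\<sigma> j l. if j \<le> inv \<sigma> l \<and> inv \<sigma> l < k then P else idm (?K l))"
  define T where "T = (\<lambda>\<sigma> j. tensor_matrix n (E \<sigma> j) x)"
  note hom = homogeneous_sym_factor[OF A P]
  have homD: "homogeneous (?K j) (?K j) (if j = l then s else 0) (?d l j)" for j l
    using homogeneous_differential_factor[of ?K j s Ds l] D by simp

  \<comment> \<open>Away from \<open>\<sigma> j\<close> the differential meets only \<open>P\<close>
    or an identity, and it commutes with both; so the two odd maps anticommute.\<close>
  have off: "koszul_map n l (?d l) (W \<sigma> j x) + W \<sigma> j (koszul_map n l (?d l) x) = 0"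
    if \<sigma>: "\<sigma> permutes {..<k}" and "j < k" "l < n" "l \<noteq> \<sigma> j" for \<sigma> j l
  proof -
    have "\<sigma> j < k" using that by (simp add: permutes_less)
    have "?d l m \<odot> sym_factor A P k \<sigma> j m = sym_factor A P k \<sigma> j m \<odot> ?d l m" for m
    proof (cases "m = l")
      case True
      then have "inv \<sigma> m \<noteq> j"
        using that permutes_inverses(1)[OF \<sigma>, of m] by auto
      moreover have "?K (inv \<sigma> m) = ?K m"
        by (rule star_factor_permutes[OF permutes_inv[OF \<sigma>]])
      moreover have "inv \<sigma> m < k \<Longrightarrow> ?K m = star_interval"
        by (simp add: permutes_less_inv[OF \<sigma>] star_factor_def)
      ultimately show ?thesis
        using True idm_mult[OF D] DP
        by (simp add: differential_factor_def homotopy_factor_def Ds_def)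
    next
      case False
      then show ?thesis
        using idm_mult[OF hom[OF \<open>j < k\<close> \<sigma>]] by (simp add: differential_factor_def)
    qed
    then show ?thesis
      unfolding W_def using \<open>\<sigma> j < k\<close> \<open>k \<le> n\<close> that
      by (intro koszul_map_anticommute[where K = ?K and r = s and s = r] homD hom \<open>odd r\<close> \<open>odd s\<close>) auto
  qed

  \<comment> \<open>In the slot \<open>\<sigma> j\<close> the twists cancel and the two products add
    up to 1 - \<open>P\<close> there; linearity in that slot splits this into the two neighbouring
    terms.\<close>
  have diag: "koszul_map n (\<sigma> j) (?d (\<sigma> j)) (W \<sigma> j x) + W \<sigma> j (koszul_map n (\<sigma> j) (?d (\<sigma> j)) x)
      = T \<sigma> (Suc j) - T \<sigma> j" if \<sigma>: "\<sigma> permutes {..<k}" and j: "j < k" for \<sigma> j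
  proof -
    let ?u = "\<sigma> j" and ?B = "sym_factor A P k \<sigma> j"
    have u: "?u < k" "?u < n" "?K ?u = star_interval" "inv \<sigma> ?u = j"
      using that \<open>k \<le> n\<close> permutes_less[OF \<sigma>, of j] permutes_inverses[OF \<sigma>]
      by (simp_all add: star_factor_def)
    have inv_eq: "inv \<sigma> l = j \<longleftrightarrow> l = ?u" for l
      using permutes_inverses[OF \<sigma>] by auto
    have self: "homotopy_factor A P k j j = A"
      by (simp add: homotopy_factor_def)
    have 1: "koszul_map n ?u (?d ?u) (W \<sigma> j x) = tensor_matrix n (?B(?u := D star_interval \<odot> A)) x"
      unfolding W_def
      by (subst koszul_map_same_position[where K = ?K and L = ?K and s = r], rule hom[OF j \<sigma>],
          rule tensor_matrix_cong)
        (use idm_mult[OF hom[OF j \<sigma>]] self u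
          in \<open>simp add: differential_factor_def Ds_def\<close>)
    have 2: "W \<sigma> j (koszul_map n ?u (?d ?u) x) = tensor_matrix n (?B(?u := A \<odot> D star_interval)) x"
      unfolding W_def
      by (subst koszul_map_same_position[where K = ?K and L = ?K and s = s], rule homD,
          rule tensor_matrix_cong)
        (use idm_mult[OF hom[OF j \<sigma>]] self u
          in \<open>simp add: differential_factor_def Ds_def\<close>)
    have star: "?K (inv \<sigma> l) = ?K l" for l
      by (rule star_factor_permutes[OF permutes_inv[OF \<sigma>]])
    have 3: "T \<sigma> (Suc j) = tensor_matrix n (?B(?u := idm star_interval)) x"
      unfolding T_def
    proof (rule tensor_matrix_cong)
      fix l
      show "E \<sigma> (Suc j) l = (?B(?u := idm star_interval)) l"
        using u inv_eq[of l] star[of l] by (cases "l = ?u") (auto simp: E_def homotopy_factor_def)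
    qed
    have 4: "T \<sigma> j = tensor_matrix n (?B(?u := P)) x"
      unfolding T_def
    proof (rule tensor_matrix_cong)
      fix l
      show "E \<sigma> j l = (?B(?u := P)) l"
        using u j inv_eq[of l] star[of l] by (cases "l = ?u") (auto simp: E_def homotopy_factor_def)
    qed
    show ?thesis
      unfolding 1 2 3 4 DA[symmetric] tensor_matrix_factor_add[OF u(2)]
      by (simp only: add_diff_cancel_right')
  qed

  have sum_j: "(\<Sum>l<n. koszul_map n l (?d l) (W \<sigma> j x) + W \<sigma> j (koszul_map n l (?d l) x))
      = T \<sigma> (Suc j) - T \<sigma> j" if \<sigma>: "\<sigma> permutes {..<k}" and j: "j < k" for \<sigma> j
  proof -
    have "\<sigma> j < n" using that \<open>k \<le> n\<close> permutes_less[OF \<sigma>, of j] by auto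
    have "(\<Sum>l<n. koszul_map n l (?d l) (W \<sigma> j x) + W \<sigma> j (koszul_map n l (?d l) x))
      = (\<Sum>l<n. if l = \<sigma> j then T \<sigma> (Suc j) - T \<sigma> j else 0)"
      using off[OF that] diag[OF that] by (intro sum.cong) auto
    then show ?thesis using \<open>\<sigma> j < n\<close> by simp
  qed

  have sum_\<sigma>: "(\<Sum>j<k. total_differential n ?K Ds (W \<sigma> j x) + W \<sigma> j (total_differential n ?K Ds x))
      = x - tensor_matrix n (\<lambda>j. if j < k then P else idm interval) x"
    if \<sigma>: "\<sigma> permutes {..<k}" for \<sigma>
  proof -
    have "(\<Sum>j<k. total_differential n ?K Ds (W \<sigma> j x) + W \<sigma> j (total_differential n ?K Ds x))
        = (\<Sum>j<k. T \<sigma> (Suc j) - T \<sigma> j)"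
    proof (rule sum.cong[OF refl])
      fix j assume "j \<in> {..<k}"
      then have "j < k" by simp
      show "total_differential n ?K Ds (W \<sigma> j x) + W \<sigma> j (total_differential n ?K Ds x)
          = T \<sigma> (Suc j) - T \<sigma> j"
        unfolding sum_j[OF \<sigma> \<open>j < k\<close>, symmetric] sum.distrib
        by (simp only: total_differential_def W_def koszul_map_linear)
    qed
    also have "\<dots> = T \<sigma> k - T \<sigma> 0"
      by (rule sum_lessThan_telescope)
    also have "T \<sigma> k = x"
    proof -
      have "T \<sigma> k = tensor_matrix n (\<lambda>l. idm (?K l)) x"
        unfolding T_def by (rule tensor_matrix_cong) (auto simp: E_def)
      then show ?thesis using tensor_matrix_idm[OF x] by simp
    qed
    also have "T \<sigma> 0 = tensor_matrix n (\<lambda>j. if j < k then P else idm interval) x"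
      unfolding T_def
      by (rule tensor_matrix_cong) (simp add: E_def permutes_less_inv[OF \<sigma>] star_factor_def)
    finally show ?thesis .
  qed

  have lin_scale: "total_differential n ?K Ds (t *\<^sub>v y) = t *\<^sub>v total_differential n ?K Ds y" for t y
    by (simp only: total_differential_def koszul_map_linear scale_sum)
  have lin_nat: "total_differential n ?K Ds (\<Sum>i\<in>J. f i) = (\<Sum>i\<in>J. total_differential n ?K Ds (f i))"
    for J :: "nat set" and f
    unfolding total_differential_def koszul_map_linear by (rule sum.swap)
  have lin_perm: "total_differential n ?K Ds (\<Sum>i\<in>J. f i) = (\<Sum>i\<in>J. total_differential n ?K Ds (f i))"
    for J :: "(nat \<Rightarrow> nat) set" and f
    unfolding total_differential_def koszul_map_linear by (rule sum.swap)
  have S: "symmetrized_homotopy A P k n y = (1 / fact k) *\<^sub>v (\<Sum>\<sigma> | \<sigma> permutes {..<k}. \<Sum>j<k. W \<sigma> j y)" for y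
    by (simp only: symmetrized_homotopy_def W_def)
  have "total_differential n ?K Ds (symmetrized_homotopy A P k n x)
      + symmetrized_homotopy A P k n (total_differential n ?K Ds x)
    = (1 / fact k) *\<^sub>v (\<Sum>\<sigma> | \<sigma> permutes {..<k}. \<Sum>j<k.
        total_differential n ?K Ds (W \<sigma> j x) + W \<sigma> j (total_differential n ?K Ds x))"
    by (simp only: S lin_scale lin_perm lin_nat scale_add[symmetric] sum.distrib)
  also have "\<dots> = (1 / fact k) *\<^sub>v (\<Sum>\<sigma> | \<sigma> permutes {..<k}.
      x - tensor_matrix n (\<lambda>j. if j < k then P else idm interval) x)"
    by (rule arg_cong[where f = "\<lambda>y. _ *\<^sub>v y"], rule sum.cong[OF refl], rule sum_\<sigma>) simp
  also have "\<dots> = x - tensor_matrix n (\<lambda>j. if j < k then P else idm interval) x"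
  proof
    fix c
    \<comment> \<open>All permutations contribute the same vector, so the normalisation cancels
      against their number.\<close>
    have "card {\<sigma>. \<sigma> permutes {..<k}} = fact k"
      by (rule card_permutations) simp_all
    then show "((1 / fact k) *\<^sub>v (\<Sum>\<sigma> | \<sigma> permutes {..<k}.
        x - tensor_matrix n (\<lambda>j. if j < k then P else idm interval) x)) c
      = (x - tensor_matrix n (\<lambda>j. if j < k then P else idm interval) x) c"
      unfolding scale_def sum_fun_apply by simp
  qed
  finally show ?thesis .
qed

section \<open>The welding retraction\<close>

definition "cube_bd n = total_differential n (\<lambda>_. interval) (\<lambda>_. bdm interval)"
definition "star_cube_bd k n = total_differential n (star_factor k) (\<lambda>j. bdm (star_factor k j))"

lemma chain_retraction:
  assumes "k \<le> n"
  shows "special_deformation_retraction cell_deg (- 1)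
    (box n (star_factor k)) (star_cube_bd k n) (box n (\<lambda>_. interval)) (cube_bd n)
    (tensor_matrix n (cube_incl k)) (tensor_matrix n (cube_proj k))
    (symmetrized_homotopy htpy incl_proj k n)"
proof -
  let ?X = "box n (star_factor k)" and ?Y = "box n (\<lambda>_. interval)"
  let ?i = "tensor_matrix n (cube_incl k)" and ?p = "tensor_matrix n (cube_proj k)"
    and ?a = "symmetrized_homotopy htpy incl_proj k n"
  have star2: "bdm (star_factor k j) \<odot> bdm (star_factor k j) = 0" for j
    by (simp add: star_factor_def bdm_bdm_interval bdm_bdm_star)
  have "is_complex cell_deg (- 1) ?X (star_cube_bd k n)"
    unfolding is_complex_def star_cube_bd_def
    by (intro conjI ballI total_differential_graded homogeneous_bdm
        total_differential_square[where r = "-1"] star2) simp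
  moreover have "is_complex cell_deg (- 1) ?Y (cube_bd n)"
    unfolding is_complex_def cube_bd_def
    by (intro conjI ballI total_differential_graded homogeneous_maps(2)
        total_differential_square[where r = "-1"] bdm_bdm_interval) simp
  moreover have "is_complex_map cell_deg ?Y (cube_bd n) ?X (star_cube_bd k n) ?i"
    unfolding is_complex_map_def cube_bd_def star_cube_bd_def
  proof (intro conjI ballI)
    show "graded_map cell_deg ?Y ?X 0 ?i"
      by (rule tensor_matrix_graded, rule homogeneous_cube_incl) simp
    show "total_differential n (star_factor k) (\<lambda>j. bdm (star_factor k j)) (?i y)
      = ?i (total_differential n (\<lambda>_. interval) (\<lambda>_. bdm interval) y)" for y
      by (rule total_differential_chain_map, rule homogeneous_cube_incl)
        (simp add: star_factor_def bdm_incl idm_mult[OF homogeneous_maps(2)])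
  qed
  moreover have "is_complex_map cell_deg ?X (star_cube_bd k n) ?Y (cube_bd n) ?p"
    unfolding is_complex_map_def cube_bd_def star_cube_bd_def
  proof (intro conjI ballI)
    show "graded_map cell_deg ?X ?Y 0 ?p"
      by (rule tensor_matrix_graded, rule homogeneous_cube_proj) simp
    show "total_differential n (\<lambda>_. interval) (\<lambda>_. bdm interval) (?p x)
      = ?p (total_differential n (star_factor k) (\<lambda>j. bdm (star_factor k j)) x)" for x
      by (rule total_differential_chain_map, rule homogeneous_cube_proj)
        (simp add: star_factor_def bdm_proj idm_mult[OF homogeneous_maps(2)])
  qed
  moreover have "graded_map cell_deg ?X ?X (- (- 1)) ?a"
    using symmetrized_homotopy_graded[OF homogeneous_maps(6) homogeneous_incl_proj assms] by simp
  moreover have "?p (?i y) = y" if "y \<in> free_space ?Y" for y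
  proof -
    have "?p (?i y) = tensor_matrix n (\<lambda>j. idm interval) y"
      unfolding tensor_matrix_mult
      by (rule tensor_matrix_cong) (simp add: proj_incl idm_mult[OF homogeneous_maps(1)])
    then show ?thesis using tensor_matrix_idm[OF that] by simp
  qed
  moreover have "star_cube_bd k n (?a x) + ?a (star_cube_bd k n x) = x - ?i (?p x)"
    if "x \<in> free_space ?X" for x
  proof -
    have "bdm star_interval \<odot> incl_proj = incl_proj \<odot> bdm star_interval"
      unfolding incl_proj_eq mat_mult_assoc[symmetric] bdm_incl
      unfolding mat_mult_assoc bdm_proj ..
    moreover have "bdm star_interval \<odot> htpy + htpy \<odot> bdm star_interval + incl_proj = idm star_interval"
      unfolding incl_proj_eq bdm_htpy by (simp only: diff_add_cancel)
    ultimately have "star_cube_bd k n (?a x) + ?a (star_cube_bd k n x)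
      = x - tensor_matrix n (\<lambda>j. if j < k then incl_proj else idm interval) x"
      unfolding star_cube_bd_def
      by (intro symmetrized_homotopy_identity[where s = "-1" and r = 1 and D = bdm]
          homogeneous_bdm homogeneous_maps homogeneous_incl_proj assms that) simp_all
    also have "tensor_matrix n (\<lambda>j. if j < k then incl_proj else idm interval) x = ?i (?p x)"
      unfolding tensor_matrix_mult
      by (rule tensor_matrix_cong) (simp add: incl_proj_eq idm_mult[OF homogeneous_maps(1)])
    finally show ?thesis .
  qed
  moreover have "?a (?a x) = 0" for x
  proof (rule symmetrized_homotopy_square[OF homogeneous_maps(6) homogeneous_incl_proj assms])
    show "htpy \<odot> incl_proj = 0" "incl_proj \<odot> htpy = 0"
      unfolding incl_proj_eq mat_mult_assoc[symmetric] htpy_incl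
      unfolding mat_mult_assoc proj_htpy by (simp_all add: mat_mult_def fun_eq_iff)
  qed (simp_all add: htpy_htpy)
  moreover have "?a (?i y) = 0" for y
    by (rule symmetrized_homotopy_tensor_matrix[OF _ assms], rule homogeneous_cube_incl)
      (simp add: htpy_incl)
  moreover have "?p (?a x) = 0" for x
    by (rule tensor_matrix_symmetrized_homotopy[OF assms]) (simp add: proj_htpy)
  ultimately show ?thesis
    by (simp add: special_deformation_retraction_def)
qed

section \<open>The cochain complexes and maps as transposes\<close>

definition "cube_cobd n =
  total_differential n (\<lambda>_. interval) (\<lambda>_. matrix_on interval (coboundary1 interval))"
definition "star_cube_cobd k n =
  total_differential n (star_factor k) (\<lambda>j. matrix_on (star_factor k j) (coboundary1 (star_factor k j)))"

abbreviation "cube_incl_dual k j \<equiv> (if j < k then matrix_on interval iu else idm interval)"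
abbreviation "cube_proj_dual k j \<equiv> (if j < k then matrix_on star_interval pu else idm interval)"

lemma homogeneous_transpose:
  assumes "homogeneous X Y r F" and "\<And>c c'. G c c' = F c' c"
  shows "homogeneous Y X (- r) G"
  using assms by (simp add: homogeneous_def)

text \<open>\<open>iu\<close> is the transpose of \<open>pl\<close> and \<open>pu\<close> that of
  \<open>il\<close>, so reversing the order of composition yields a composite of the same shape,
  inclusion after projection.\<close>

lemma upper_comp_matrix:
  "matrix_on star_interval (iu \<circ> pu) c c' = incl_proj c' c"
proof -
  have "homogeneous star_interval interval (- 0) (matrix_on star_interval pu)"
    by (rule homogeneous_transpose[OF homogeneous_maps(4)]) (rule upper_matrix(2))
  then have "matrix_on interval iu \<odot> matrix_on star_interval pu = matrix_on star_interval (iu \<circ> pu)"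
    unfolding iu_def comp_def by (rule matrix_on_mult)
  then have "matrix_on star_interval (iu \<circ> pu) c c'
      = (\<Sum>b\<in>UNIV. matrix_on interval iu c b * matrix_on star_interval pu b c')"
    by (simp add: mat_mult_def fun_eq_iff)
  then show ?thesis
    by (simp add: upper_matrix incl_proj_eq mat_mult_def mult.commute)
qed

lemma coboundary_star_factor:
  "matrix_on (star_factor k j) (coboundary1 (star_factor k j)) c c' = bdm (star_factor k j) c' c"
  by (rule coboundary_matrix) (simp add: star_factor_def)

text \<open>The five parts stand in the order of the \<open>tr\<close> premises of
  \<open>special_deformation_retraction_transpose\<close>, so that they can be supplied as one
  list.\<close>

lemma cochain_transposes:
  assumes "k \<le> n"
  defines "X \<equiv> box n (star_factor k)" and "Y \<equiv> box n (\<lambda>_. interval)"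
  shows "is_transpose X X (star_cube_bd k n) (star_cube_cobd k n)"
    and "is_transpose Y Y (cube_bd n) (cube_cobd n)"
    and "is_transpose X Y (tensor_matrix n (cube_proj k)) (tensor_matrix n (cube_incl_dual k))"
    and "is_transpose Y X (tensor_matrix n (cube_incl k)) (tensor_matrix n (cube_proj_dual k))"
    and "is_transpose X X (symmetrized_homotopy htpy incl_proj k n)
      (symmetrized_homotopy (matrix_on star_interval au) (matrix_on star_interval (iu \<circ> pu)) k n)"
proof -
  show "is_transpose X X (star_cube_bd k n) (star_cube_cobd k n)"
    unfolding X_def star_cube_bd_def star_cube_cobd_def
    by (rule total_differential_transpose, rule homogeneous_bdm, rule coboundary_star_factor)
  show "is_transpose Y Y (cube_bd n) (cube_cobd n)"
    unfolding Y_def cube_bd_def cube_cobd_def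
    by (rule total_differential_transpose, rule homogeneous_maps(2), rule coboundary_matrix) simp
  show "is_transpose X Y (tensor_matrix n (cube_proj k)) (tensor_matrix n (cube_incl_dual k))"
    unfolding X_def Y_def
    by (rule tensor_matrix_transpose, rule homogeneous_cube_proj)
      (auto simp: upper_matrix matrix_on_def[of _ id] delta_def)
  show "is_transpose Y X (tensor_matrix n (cube_incl k)) (tensor_matrix n (cube_proj_dual k))"
    unfolding X_def Y_def
    by (rule tensor_matrix_transpose, rule homogeneous_cube_incl)
      (auto simp: upper_matrix matrix_on_def[of _ id] delta_def)
  show "is_transpose X X (symmetrized_homotopy htpy incl_proj k n)
      (symmetrized_homotopy (matrix_on star_interval au) (matrix_on star_interval (iu \<circ> pu)) k n)"
    unfolding X_def
    by (rule symmetrized_homotopy_transpose[OF homogeneous_maps(6) homogeneous_incl_proj assms(1)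
        upper_matrix(3) upper_comp_matrix])
qed

theorem mainTheorem8:
  fixes k n :: nat
  assumes "1 \<le> k" and "k \<le> n"
  shows
    "special_deformation_retraction cell_deg (- 1)
       (star_cube k n) (boundary (star_cube_factors k n))
       (cube n) (boundary (cube_factors n))
       (il_cube k n) (pl_cube k n) (al_cube k n)
     \<and> special_deformation_retraction cell_deg 1
       (star_cube k n) (coboundary (star_cube_factors k n))
       (cube n) (coboundary (cube_factors n))
       (iu_cube k n) (pu_cube k n) (au_cube k n)
     \<and> is_transpose (star_cube k n) (star_cube k n)
         (boundary (star_cube_factors k n)) (coboundary (star_cube_factors k n))
     \<and> is_transpose (cube n) (cube n)
         (boundary (cube_factors n)) (coboundary (cube_factors n))
     \<and> is_transpose (star_cube k n) (cube n) (pl_cube k n) (iu_cube k n)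
     \<and> is_transpose (cube n) (star_cube k n) (il_cube k n) (pu_cube k n)
     \<and> is_transpose (star_cube k n) (star_cube k n) (al_cube k n) (au_cube k n)"
proof -
  note kn = \<open>k \<le> n\<close>
  let ?X = "box n (star_factor k)" and ?Y = "box n (\<lambda>_. interval)"
  have sb: "boundary (star_cube_factors k n) x = star_cube_bd k n x" if "x \<in> free_space ?X" for x
    unfolding star_cube_bd_def total_differential_def using that kn by (intro boundary_eq) auto
  have b: "boundary (cube_factors n) y = cube_bd n y" if "y \<in> free_space ?Y" for y
    unfolding cube_bd_def total_differential_def using that by (intro boundary_eq) auto
  have sc: "coboundary (star_cube_factors k n) x = star_cube_cobd k n x" if "x \<in> free_space ?X" for x
    unfolding star_cube_cobd_def total_differential_def
    using that kn by (intro coboundary_eq) (auto simp: nth_star_cube_factors)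
  have c: "coboundary (cube_factors n) y = cube_cobd n y" if "y \<in> free_space ?Y" for y
    unfolding cube_cobd_def total_differential_def
    using that by (intro coboundary_eq) (auto simp: nth_cube_factors)
  have star_power: "tensor_power_id f k n x
      = tensor_matrix n (\<lambda>j. if j < k then matrix_on star_interval f else idm interval) x"
    if "x \<in> free_space ?X" for f x
    unfolding tensor_power_id_eq[OF kn that]
    by (rule tensor_matrix_cong) (simp add: star_factor_def)
  have power: "tensor_power_id f k n y
      = tensor_matrix n (\<lambda>j. if j < k then matrix_on interval f else idm interval) y"
    if "y \<in> free_space ?Y" for f y
    by (rule tensor_power_id_eq[OF kn that])
  have a: "al_cube k n x = symmetrized_homotopy htpy incl_proj k n x" if "x \<in> free_space ?X" for x
    unfolding al_cube_def using that kn homogeneous_maps(6) homogeneous_incl_proj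
    by (intro weld_homotopy_eq) (auto simp: star_cube_eq_box)
  have au: "au_cube k n x = symmetrized_homotopy (matrix_on star_interval au)
      (matrix_on star_interval (iu \<circ> pu)) k n x" if "x \<in> free_space ?X" for x
    unfolding au_cube_def
    using that kn homogeneous_transpose[OF homogeneous_maps(6) upper_matrix(3)]
      homogeneous_transpose[OF homogeneous_incl_proj upper_comp_matrix]
    by (intro weld_homotopy_eq) (auto simp: star_cube_eq_box)
  note tr = cochain_transposes[OF kn]
  note chains = chain_retraction[OF kn]
  \<comment> \<open>The differential of the dual has degree \<open>- (- 1)\<close> here;
    \<open>simplified\<close> below turns it into 1.\<close>
  note cochains = special_deformation_retraction_transpose[OF finite_box finite_box chains tr]
  show ?thesis
    unfolding star_cube_eq_box[OF kn] cube_eq_box il_cube_def pl_cube_def iu_cube_def pu_cube_def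
    by (intro conjI special_deformation_retraction_cong[OF chains]
        special_deformation_retraction_cong[OF cochains[simplified]] tr[THEN is_transpose_cong]
        sb b sc c star_power power a au)
qed

end
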